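(* Let $\sigma_1,\sigma_2>0$ and $\Omega=\mathbb{R}$. Fix $-\pi/2<\theta<\pi/2$ and $\omega,k\in\mathbb{R}$ such that $\omega\cos\theta+k\sin\theta\ne 0$. Define $$d=\frac{k\cos\theta-\omega\sin\theta+\sqrt{\omega^2+k^2}}{\omega\cos\theta+k\sin\theta},$$ and let $\gamma_j\in(-\pi,\pi]$ $(j=1,2)$ be the unique solutions of $$\tan(\gamma_j-\theta)=\frac{d(\sigma_j+4)}{\sigma_j+2-2d^2},\qquad d\sin(\gamma_j-\theta)+\cos(\gamma_j-\theta)>0.$$ Set $$\epsilon=\frac{\sqrt{\omega^2+k^2}}{1+d^2},\qquad \eta_j=\frac{d\sin(\gamma_j-\theta)+\cos(\gamma_j-\theta)}{1+d^2}\quad(j=1,2).$$ For $\chi\in\{1,-1\}$ consider the equation $$i\omega\phi=e^{i\theta}\phi''+e^{i\gamma_1}|\phi|^{\sigma_1}\phi+\chi e^{i\gamma_2}|\phi|^{\sigma_2}\phi+k\phi,\qquad \phi\in H^1(\mathbb{R}).\qquad(\ast)$$ (a) If $\chi=1$, then the generalized complex Ginzburg-Landau equation admits a bound-state (a solution of $(\ast)$) of the form $$\phi=\psi\exp(id\ln\psi),\qquad(\ast\ast)$$ where $\psi$ is the bound-state for the nonlinear Schrödinger equation $$\psi''=\epsilon\psi-\eta_1\psi^{\sigma_1+1}-\chi\eta_2\psi^{\sigma_2+1}\quad\text{on }\mathbb{R}.\qquad(\ast\ast\ast)$$ (b) If $\chi=-1$, there exists a small enough $\delta>0$ such that for $0<\sigma_2<\delta$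 the generalized complex Ginzburg-Landau equation admits a bound-state of the form $(\ast\ast)$ with $\psi$ the bound-state for the nonlinear Schrödinger equation satisfying $(\ast\ast\ast)$.
   Context: The generalized complex Ginzburg-Landau equation in trigonometric form is $u_t=e^{i\theta}\Delta u+e^{i\gamma_1}|u|^{\sigma_1}u+\chi e^{i\gamma_2}|u|^{\sigma_2}u+ku$. A bound-state is a nontrivial complex-valued $\phi\in H^1(\mathbb{R})$ solving $(\ast)$, so that $u=e^{i\omega t}\phi(x)$ solves the evolution equation. The bound-state $\psi$ for the nonlinear Schrödinger equation $(\ast\ast\ast)$ means its positive solution $\psi\in H^1(\mathbb{R})$, $\psi>0$ (unique up to translations). *)

theory Defs
  imports "HOL-Analysis.Analysis"
begin

section \<open>The Sobolev space \<open>H\<^sup>1(\<real>)\<close>\<close>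

definition test_function :: "(real \<Rightarrow> real) \<Rightarrow> bool" where
  "test_function v \<longleftrightarrow>
     (\<forall>n x. ((deriv ^^ n) v) field_differentiable (at x)) \<and>
     (\<exists>R. \<forall>x. \<bar>x\<bar> > R \<longrightarrow> v x = 0)"

definition square_integrable :: "(real \<Rightarrow> 'a::euclidean_space) \<Rightarrow> bool" where
  "square_integrable f \<longleftrightarrow>
     f \<in> borel_measurable lborel \<and> integrable lborel (\<lambda>x. (norm (f x))\<^sup>2)"

text \<open>Intended for locally integrable \<open>f\<close> and \<open>g\<close>, for which both integrands are integrable.\<close>

definition weak_derivative :: "(real \<Rightarrow> 'a::euclidean_space) \<Rightarrow> (real \<Rightarrow> 'a) \<Rightarrow> bool" where
  "weak_derivative f g \<longleftrightarrow>
     (\<forall>v. test_function v \<longrightarrow>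
        (LINT x|lborel. deriv v x *\<^sub>R f x) = - (LINT x|lborel. v x *\<^sub>R g x))"

definition sobolev_H1 :: "(real \<Rightarrow> 'a::euclidean_space) \<Rightarrow> bool" where
  "sobolev_H1 f \<longleftrightarrow>
     square_integrable f \<and> (\<exists>g. square_integrable g \<and> weak_derivative f g)"

section \<open>Bound-states\<close>

text \<open>
  The sign in front of the second nonlinearity is called \<open>c\<close>, the usual letter being the vector binder.
  Derivatives in both equations are classical and the equations hold at every point. Since the
  nonlinearities are continuous, every \<open>H\<^sup>1\<close> distributional solution has such a representative.
\<close>

definition cgl_bound_state ::
    "real \<Rightarrow> real \<Rightarrow> real \<Rightarrow> real \<Rightarrow> real \<Rightarrow> real \<Rightarrow> real \<Rightarrow> real \<Rightarrow> (real \<Rightarrow> complex) \<Rightarrow> bool" where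
  "cgl_bound_state \<theta> \<gamma>1 \<gamma>2 \<sigma>1 \<sigma>2 c \<omega> k \<phi> \<longleftrightarrow>
     (\<exists>x. \<phi> x \<noteq> 0) \<and> sobolev_H1 \<phi> \<and>
     (\<exists>\<phi>' \<phi>''. \<forall>x.
        (\<phi> has_vector_derivative \<phi>' x) (at x) \<and>
        (\<phi>' has_vector_derivative \<phi>'' x) (at x) \<and>
        \<i> * of_real \<omega> * \<phi> x =
          exp (\<i> * of_real \<theta>) * \<phi>'' x
          + exp (\<i> * of_real \<gamma>1) * of_real (norm (\<phi> x) powr \<sigma>1) * \<phi> x
          + of_real c * exp (\<i> * of_real \<gamma>2) * of_real (norm (\<phi> x) powr \<sigma>2) * \<phi> x
          + of_real k * \<phi> x)"

definition nls_positive_solution ::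
    "real \<Rightarrow> real \<Rightarrow> real \<Rightarrow> real \<Rightarrow> real \<Rightarrow> real \<Rightarrow> (real \<Rightarrow> real) \<Rightarrow> bool" where
  "nls_positive_solution \<epsilon> \<eta>1 \<eta>2 \<sigma>1 \<sigma>2 c \<psi> \<longleftrightarrow>
     (\<forall>x. \<psi> x > 0) \<and> sobolev_H1 \<psi> \<and>
     (\<exists>\<psi>' \<psi>''. \<forall>x.
        (\<psi> has_real_derivative \<psi>' x) (at x) \<and>
        (\<psi>' has_real_derivative \<psi>'' x) (at x) \<and>
        \<psi>'' x = \<epsilon> * \<psi> x - \<eta>1 * \<psi> x powr (\<sigma>1 + 1) - c * \<eta>2 * \<psi> x powr (\<sigma>2 + 1))"

text \<open>The definite article in ``the bound-state'' is rendered as uniqueness up to translations.\<close>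

definition nls_bound_state ::
    "real \<Rightarrow> real \<Rightarrow> real \<Rightarrow> real \<Rightarrow> real \<Rightarrow> real \<Rightarrow> (real \<Rightarrow> real) \<Rightarrow> bool" where
  "nls_bound_state \<epsilon> \<eta>1 \<eta>2 \<sigma>1 \<sigma>2 c \<psi> \<longleftrightarrow>
     nls_positive_solution \<epsilon> \<eta>1 \<eta>2 \<sigma>1 \<sigma>2 c \<psi> \<and>
     (\<forall>\<psi>0. nls_positive_solution \<epsilon> \<eta>1 \<eta>2 \<sigma>1 \<sigma>2 c \<psi>0 \<longrightarrow> (\<exists>a. \<forall>x. \<psi>0 x = \<psi> (x + a)))"

section \<open>The parameters\<close>

definition d_param :: "real \<Rightarrow> real \<Rightarrow> real \<Rightarrow> real" where
  "d_param \<theta> \<omega> k =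
     (k * cos \<theta> - \<omega> * sin \<theta> + sqrt (\<omega>\<^sup>2 + k\<^sup>2)) / (\<omega> * cos \<theta> + k * sin \<theta>)"

text \<open>
  If \<open>\<sigma> + 2 - 2 * d\<^sup>2 = 0\<close>, the right-hand side of the tangent equation is infinite (\<open>d \<noteq> 0\<close>), and
  the equation means that \<open>\<gamma> - \<theta>\<close> is a pole of the tangent. This case is separated because
  of the convention \<open>x / 0 = 0\<close>.
\<close>

definition is_gamma :: "real \<Rightarrow> real \<Rightarrow> real \<Rightarrow> real \<Rightarrow> bool" where
  "is_gamma \<theta> d \<sigma> \<gamma> \<longleftrightarrow>
     - pi < \<gamma> \<and> \<gamma> \<le> pi \<and>
     (if \<sigma> + 2 - 2 * d\<^sup>2 = 0 then cos (\<gamma> - \<theta>) = 0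
      else tan (\<gamma> - \<theta>) = d * (\<sigma> + 4) / (\<sigma> + 2 - 2 * d\<^sup>2)) \<and>
     d * sin (\<gamma> - \<theta>) + cos (\<gamma> - \<theta>) > 0"

definition gamma_param :: "real \<Rightarrow> real \<Rightarrow> real \<Rightarrow> real" where
  "gamma_param \<theta> d \<sigma> = (THE \<gamma>. is_gamma \<theta> d \<sigma> \<gamma>)"

definition eps_param :: "real \<Rightarrow> real \<Rightarrow> real \<Rightarrow> real" where
  "eps_param d \<omega> k = sqrt (\<omega>\<^sup>2 + k\<^sup>2) / (1 + d\<^sup>2)"

definition eta_param :: "real \<Rightarrow> real \<Rightarrow> real \<Rightarrow> real" where
  "eta_param \<theta> d \<gamma> = (d * sin (\<gamma> - \<theta>) + cos (\<gamma> - \<theta>)) / (1 + d\<^sup>2)"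

definition admits_phase_bound_state ::
    "real \<Rightarrow> real \<Rightarrow> real \<Rightarrow> real \<Rightarrow> real \<Rightarrow> real \<Rightarrow> bool" where
  "admits_phase_bound_state \<theta> \<omega> k \<sigma>1 \<sigma>2 c \<longleftrightarrow>
     (let d = d_param \<theta> \<omega> k;
          \<gamma>1 = gamma_param \<theta> d \<sigma>1;
          \<gamma>2 = gamma_param \<theta> d \<sigma>2;
          \<epsilon> = eps_param d \<omega> k;
          \<eta>1 = eta_param \<theta> d \<gamma>1;
          \<eta>2 = eta_param \<theta> d \<gamma>2
      in \<exists>\<psi>. nls_bound_state \<epsilon> \<eta>1 \<eta>2 \<sigma>1 \<sigma>2 c \<psi> \<and>
             cgl_bound_state \<theta> \<gamma>1 \<gamma>2 \<sigma>1 \<sigma>2 c \<omega> k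
               (\<lambda>x. of_real (\<psi> x) * exp (\<i> * of_real d * of_real (ln (\<psi> x)))))"

end

theory Submission
  imports Defs
begin

text \<open>
  The theorem couples a complex computation with a phase plane argument.

  For \<open>\<phi> = \<psi> exp(i d ln \<psi>)\<close> one finds \<open>\<phi>'' = (1 + i d) (\<psi>'' + i d \<psi>'\<^sup>2 / \<psi>) exp(i d ln \<psi>)\<close>
  (\<open>phase_profile_derivatives\<close>). If \<open>\<psi>\<close> solves the Schroedinger equation and decays, then its energy
  vanishes, and \<open>\<psi>'\<^sup>2 / \<psi>\<close> is a combination of the same three powers of \<open>\<psi>\<close> as \<open>\<psi>''\<close>, the nonlinear ones
  being weighted by \<open>2 / (\<sigma>\<^sub>j + 2)\<close>. Comparing coefficients, the Ginzburg-Landau equation becomes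
  \<open>e\<^sup>i\<^sup>\<theta> \<epsilon> (1 + i d)\<^sup>2 = i \<omega> - k\<close> together with
  \<open>e\<^sup>i\<^sup>\<gamma> = e\<^sup>i\<^sup>\<theta> \<eta> (1 + i d) (1 + 2 i d / (\<sigma> + 2))\<close> for each nonlinearity.
  The first holds by the choice of \<open>d\<close> and \<open>\<epsilon>\<close> (\<open>d_eps_identity\<close>). The second is
  the tangent condition together with the sign condition on \<open>\<gamma>\<close> (\<open>is_gamma_imp_cis\<close>, \<open>is_gamma_of_cis\<close>); in
  this form the existence and uniqueness of \<open>\<gamma>\<close> is that of the argument of a nonzero complex number. It also
  shows \<open>\<eta> > 0\<close>.

  There remains the bound-state of \<open>u'' = f(u)\<close>. Writing the energy relation as \<open>u'\<^sup>2 = u\<^sup>2 G(u)\<close>, everything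
  depends on \<open>G(0) > 0\<close> and on a simple zero \<open>s\<^sub>0\<close> of \<open>G\<close> at which \<open>G\<close> turns negative for good. For two focusing
  nonlinearities \<open>G\<close> is decreasing. If the second one is defocusing, then \<open>\<sigma>\<^sub>2 < \<sigma>\<^sub>1\<close> suffices, so
  \<open>\<delta> = \<sigma>\<^sub>1\<close> can be taken (\<open>nls_log_slope_sq_pos_below\<close>, \<open>nls_homoclinic_profile\<close>).

  Existence (\<open>homoclinic_solution\<close>): the substitution \<open>u = s\<^sub>0 exp(-z\<^sup>2)\<close> turns the relation \<open>u'\<^sup>2 = u\<^sup>2 G(u)\<close>, which
  is singular at the turning point, into \<open>z' = n(z)\<close> with \<open>n\<close> continuous, positive and bounded on the whole
  line. Such an equation is solved globally by inverting an antiderivative of \<open>1 / n\<close>. Since \<open>G(0) > 0\<close>,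
  \<open>u\<close> decays exponentially.

  Uniqueness (\<open>square_integrable_solution_unique\<close>): a square integrable positive solution takes arbitrarily
  small values. Negative energy is then impossible, and positive energy would make the solution so steep at
  small values that it would reach zero. So the energy vanishes, at a maximum the value must be
  \<open>s\<^sub>0\<close>, and a Gronwall estimate from there identifies the solution with a translate of \<open>u\<close>.
\<close>

section \<open>Exponential decay and \<open>H\<^sup>1(\<real>)\<close>\<close>

text \<open>
  The function \<open>u x * exp (c * (x - a))\<close> is nonincreasing. For \<open>c > 0\<close> this gives decay; for \<open>c < 0\<close> it
  is the Gronwall inequality.
\<close>

lemma exp_decay_of_derivative_bound:
  fixes u u' :: "real \<Rightarrow> real"
  assumes "a \<le> x" and "\<And>y. a \<le> y \<Longrightarrow> y \<le> x \<Longrightarrow> (u has_real_derivative u' y) (at y)"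
    and "\<And>y. a \<le> y \<Longrightarrow> y \<le> x \<Longrightarrow> u' y \<le> - c * u y"
  shows "u x \<le> u a * exp (- c * (x - a))"
proof -
  have "u x * exp (c * (x - a)) \<le> u a * exp (c * (a - a))"
  proof (rule DERIV_nonpos_imp_nonincreasing[OF \<open>x \<ge> a\<close>])
    fix y assume y: "a \<le> y" "y \<le> x"
    have "((\<lambda>x. u x * exp (c * (x - a))) has_real_derivative (u' y + c * u y) * exp (c * (y - a))) (at y)"
      using assms(2)[OF y] by (auto intro!: derivative_eq_intros simp: algebra_simps)
    moreover have "(u' y + c * u y) * exp (c * (y - a)) \<le> 0"
      using assms(3)[OF y] by (simp add: mult_nonpos_nonneg)
    ultimately show "\<exists>d. ((\<lambda>x. u x * exp (c * (x - a))) has_real_derivative d) (at y) \<and> d \<le> 0" by blast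
  qed
  then have "u x * exp (c * (x - a)) * exp (- c * (x - a)) \<le> u a * exp (- c * (x - a))"
    by (intro mult_right_mono) auto
  then show ?thesis by (simp add: mult.assoc flip: exp_add)
qed


lemma integrable_exp_minus_abs:
  fixes c :: real
  assumes "c > 0"
  shows "integrable lborel (\<lambda>x. exp (- c * \<bar>x\<bar>))"
proof -
  define h where "h x = indicator {0..} x *\<^sub>R exp (- c * x)" for x :: real
  have h: "integrable lborel h"
  proof -
    have "(\<lambda>x. exp (- c * x)) absolutely_integrable_on {0..}"
      by (rule nonnegative_absolutely_integrable_1[OF integrable_on_exp_minus_to_infinity[OF assms]]) simp
    then have "integrable lebesgue h" by (simp add: set_integrable_def h_def[abs_def])
    then show ?thesis by (subst (asm) integrable_completion) (auto simp: h_def[abs_def])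
  qed
  have "integrable lborel (\<lambda>x. h (0 + (-1) * x))"
    using lborel_integrable_real_affine_iff[of "-1" h 0] h by simp
  then have "integrable lborel (\<lambda>x. h x + h (0 + (-1) * x))" using h by simp
  then show ?thesis
    by (rule Bochner_Integration.integrable_bound) (auto simp: h_def indicator_def abs_if)
qed

lemma square_integrable_exp_bound:
  fixes f :: "real \<Rightarrow> 'a::euclidean_space"
  assumes "continuous_on UNIV f" "c > 0" "\<And>x. norm (f x) \<le> C * exp (- c * \<bar>x\<bar>)"
  shows "square_integrable f"
  unfolding square_integrable_def
proof
  show b: "f \<in> borel_measurable lborel" using assms(1) by (simp add: borel_measurable_continuous_onI)
  have "integrable lborel (\<lambda>x. C\<^sup>2 * exp (- (2 * c) * \<bar>x\<bar>))"
    using integrable_exp_minus_abs[of "2 * c"] assms(2) by simp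
  then show "integrable lborel (\<lambda>x. (norm (f x))\<^sup>2)"
  proof (rule Bochner_Integration.integrable_bound)
    have "(norm (f x))\<^sup>2 \<le> C\<^sup>2 * exp (- (2 * c) * \<bar>x\<bar>)" for x
      using power_mono[OF assms(3)[of x], of 2]
      by (simp add: power_mult_distrib exp_double[symmetric] mult.assoc)
    then show "AE x in lborel. norm ((norm (f x))\<^sup>2) \<le> norm (C\<^sup>2 * exp (- (2 * c) * \<bar>x\<bar>))"
      by simp
  qed (use b in measurable)
qed

text \<open>
  The test function and its derivative vanish outside some \<open>[-R, R]\<close>, so that both integrals reduce to that
  interval, where the product rule and the fundamental theorem of calculus apply.
\<close>

lemma weak_derivative_of_classical:
  fixes f :: "real \<Rightarrow> 'a::euclidean_space"
  assumes f: "\<And>x. (f has_vector_derivative f' x) (at x)" and cont: "continuous_on UNIV f'"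
  shows "weak_derivative f f'"
  unfolding weak_derivative_def
proof (intro allI impI)
  fix v :: "real \<Rightarrow> real" assume v: "test_function v"
  then obtain R0 where R0: "\<And>x. \<bar>x\<bar> > R0 \<Longrightarrow> v x = 0" by (auto simp: test_function_def)
  define R where "R = \<bar>R0\<bar> + 1"
  have dv: "(v has_real_derivative deriv v x) (at x)" for x
    using v[unfolded test_function_def, THEN conjunct1, rule_format, of 0 x]
    by (simp add: field_differentiable_derivI)
  have ddv: "deriv v field_differentiable (at x)" for x
    using v[unfolded test_function_def, THEN conjunct1, rule_format, of 1 x] by simp
  have cdv: "continuous_on UNIV (deriv v)"
    using ddv by (simp add: continuous_at_imp_continuous_on field_differentiable_imp_continuous_at)
  have cv: "continuous_on UNIV v"
    using dv by (meson DERIV_isCont continuous_at_imp_continuous_on)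
  have cf: "continuous_on UNIV f"
    using f by (meson has_vector_derivative_continuous continuous_at_imp_continuous_on)
  have v0: "v x = 0" if "\<bar>x\<bar> \<ge> R" for x using R0 that by (simp add: R_def)
  have dv0: "deriv v x = 0" if "\<bar>x\<bar> > R" for x
  proof -
    have "(v has_real_derivative 0) (at x)"
    proof (rule has_field_derivative_transform_within_open[of "\<lambda>_. 0"])
      show "open {x. \<bar>x\<bar> > R}" by (intro open_Collect_less continuous_intros)
    qed (use that v0 in auto)
    then show ?thesis by (rule DERIV_imp_deriv)
  qed
  let ?I = "\<lambda>g. LINT x|lborel. indicator {-R..R} x *\<^sub>R (g x :: 'a)"
  have e1: "(LINT x|lborel. deriv v x *\<^sub>R f x) = ?I (\<lambda>x. deriv v x *\<^sub>R f x)"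
  proof (rule Bochner_Integration.integral_cong)
    show "deriv v x *\<^sub>R f x = indicator {-R..R} x *\<^sub>R deriv v x *\<^sub>R f x" for x
      using dv0[of x] by (cases "\<bar>x\<bar> > R") (auto simp: indicator_def)
  qed simp
  have e2: "(LINT x|lborel. v x *\<^sub>R f' x) = ?I (\<lambda>x. v x *\<^sub>R f' x)"
  proof (rule Bochner_Integration.integral_cong)
    show "v x *\<^sub>R f' x = indicator {-R..R} x *\<^sub>R v x *\<^sub>R f' x" for x
      using v0[of x] by (cases "\<bar>x\<bar> > R") (auto simp: indicator_def)
  qed simp
  have i1: "set_integrable lborel {-R..R} (\<lambda>x. deriv v x *\<^sub>R f x)"
    by (rule borel_integrable_atLeastAtMost') (use cdv cf in \<open>auto intro!: continuous_intros intro: continuous_on_subset\<close>)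
  have i2: "set_integrable lborel {-R..R} (\<lambda>x. v x *\<^sub>R f' x)"
    by (rule borel_integrable_atLeastAtMost') (use cv cont in \<open>auto intro!: continuous_intros intro: continuous_on_subset\<close>)
  have "?I (\<lambda>x. v x *\<^sub>R f' x + deriv v x *\<^sub>R f x) = v R *\<^sub>R f R - v (-R) *\<^sub>R f (-R)"
  proof (rule integral_FTC_atLeastAtMost)
    show "continuous_on {- R..R} (\<lambda>x. v x *\<^sub>R f' x + deriv v x *\<^sub>R f x)"
      using cv cont cdv cf by (auto intro!: continuous_intros intro: continuous_on_subset)
    show "((\<lambda>x. v x *\<^sub>R f x) has_vector_derivative v x *\<^sub>R f' x + deriv v x *\<^sub>R f x) (at x within {- R..R})" for x
      by (rule has_vector_derivative_at_within, rule has_vector_derivative_scaleR[OF dv f])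
  qed (simp add: R_def)
  moreover have "?I (\<lambda>x. v x *\<^sub>R f' x + deriv v x *\<^sub>R f x) = ?I (\<lambda>x. v x *\<^sub>R f' x) + ?I (\<lambda>x. deriv v x *\<^sub>R f x)"
    using set_integral_add(2)[OF i2 i1] by (simp add: set_lebesgue_integral_def)
  ultimately show "(LINT x|lborel. deriv v x *\<^sub>R f x) = - (LINT x|lborel. v x *\<^sub>R f' x)"
    using v0[of R] v0[of "-R"] by (simp add: e1 e2 eq_neg_iff_add_eq_0 add.commute R_def)
qed

lemma sobolev_H1_of_exp_decay:
  fixes f :: "real \<Rightarrow> 'a::euclidean_space"
  assumes f: "\<And>x. (f has_vector_derivative f' x) (at x)" and cont: "continuous_on UNIV f'"
    and "c > 0" and "\<And>x. norm (f x) \<le> C * exp (- c * \<bar>x\<bar>)"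
    and "\<And>x. norm (f' x) \<le> C' * exp (- c * \<bar>x\<bar>)"
  shows "sobolev_H1 f"
proof -
  have cf: "continuous_on UNIV f"
    using f by (meson has_vector_derivative_continuous continuous_at_imp_continuous_on)
  show ?thesis unfolding sobolev_H1_def
    using square_integrable_exp_bound[OF cf] square_integrable_exp_bound[OF cont]
      weak_derivative_of_classical[OF f cont] assms by blast
qed

section \<open>Scalar equations on the line\<close>

lemma antiderivative_on_line:
  fixes g :: "real \<Rightarrow> real"
  assumes "continuous_on UNIV g"
  obtains W where "\<And>x. (W has_real_derivative g x) (at x)"
proof -
  have "\<exists>X. \<forall>t::real. -\<infinity> < ereal t \<longrightarrow> ereal t < \<infinity> \<longrightarrow> (X has_vector_derivative g t) (at t)"
    by (rule einterval_antiderivative) (use assms in \<open>auto simp: continuous_on_eq_continuous_at\<close>)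
  then show ?thesis using that by (auto simp: has_real_derivative_iff_has_vector_derivative)
qed

text \<open>
  Separation of variables: \<open>z\<close> is the inverse of an antiderivative \<open>X\<close> of \<open>1 / n\<close>. The bound on \<open>n\<close> makes
  \<open>X\<close> grow at least linearly, hence onto, so the solution exists for all times.
\<close>

lemma autonomous_global_solution:
  fixes n :: "real \<Rightarrow> real"
  assumes cont: "continuous_on UNIV n" and pos: "\<And>z. 0 < n z" and bdd: "\<And>z. n z \<le> B"
  shows "\<exists>z. z 0 = 0 \<and> (\<forall>x. (z has_real_derivative n (z x)) (at x))"
proof -
  have "continuous_on UNIV (\<lambda>t. inverse (n t))"
    using cont pos by (intro continuous_intros) (auto simp: less_imp_neq[symmetric])
  from antiderivative_on_line[OF this]
  obtain X0 where X0: "\<And>t. (X0 has_real_derivative inverse (n t)) (at t)"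
    by blast
  define X where "X t = X0 t - X0 0" for t
  have X: "(X has_real_derivative inverse (n t)) (at t)" for t
    unfolding X_def using X0[of t] by (auto intro!: derivative_eq_intros)
  have Xcont: "continuous_on S X" for S
    by (meson X DERIV_isCont continuous_at_imp_continuous_on)
  have less: "X s < X t" if "s < t" for s t
    by (rule DERIV_pos_imp_increasing[OF that]) (use X pos in \<open>metis positive_imp_inverse_positive\<close>)
  have B: "B > 0" using pos[of 0] bdd[of 0] by simp
  have growth: "X s - s / B \<le> X t - t / B" if "s \<le> t" for s t
  proof (rule DERIV_nonneg_imp_nondecreasing[OF that])
    fix u
    have "((\<lambda>t. X t - t / B) has_real_derivative inverse (n u) - 1 / B) (at u)"
      using X[of u] B by (auto intro!: derivative_eq_intros)
    moreover have "inverse (n u) - 1 / B \<ge> 0"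
      using le_imp_inverse_le[OF bdd[of u] pos[of u]] by (simp add: inverse_eq_divide)
    ultimately show "\<exists>y. ((\<lambda>t. X t - t / B) has_real_derivative y) (at u) \<and> 0 \<le> y" by blast
  qed
  have X00: "X 0 = 0" by (simp add: X_def)
  have surj: "\<exists>t. X t = x" for x
  proof (cases "x \<ge> 0")
    case True
    have "X 0 \<le> x" "x \<le> X (B * x)"
      using growth[of 0 "B * x"] B True X00 by (auto simp: mult_nonneg_nonneg)
    then show ?thesis using IVT'[of X 0 x "B * x"] Xcont B True by auto
  next
    case False
    have "X (B * x) \<le> x" "x \<le> X 0"
      using growth[of "B * x" 0] B False X00 by (auto simp: mult_pos_neg less_imp_le)
    then show ?thesis using IVT'[of X "B * x" x 0] Xcont B False by (auto simp: mult_pos_neg less_imp_le)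
  qed
  define z where "z = inv X"
  have inj: "inj X" by (metis injI less linorder_neqE_linordered_idom order_less_irrefl)
  have Xz: "X (z x) = x" for x unfolding z_def using surj by (metis f_inv_into_f rangeI)
  have zX: "z (X t) = t" for t unfolding z_def by (simp add: inj)
  have "(z has_real_derivative n (z x)) (at x)" for x
  proof -
    have "((*) (inverse (n (z x)))) \<circ> ((*) (n (z x))) = id" using pos[of "z x"] by (auto simp: o_def)
    then have "(z has_derivative (*) (n (z x))) (at (X (z x)))"
      by (intro has_derivative_inverse_strong[of UNIV "z x" X z "(*) (inverse (n (z x)))"])
        (use Xcont zX X[of "z x"] in \<open>auto simp: has_field_derivative_def\<close>)
    then show ?thesis using Xz by (simp add: has_field_derivative_def)
  qed
  moreover have "z 0 = 0" using zX[of 0] X00 by simp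
  ultimately show ?thesis by blast
qed


text \<open>
  Where \<open>v\<close> does not vanish, \<open>v = sgn v * sqrt (F u)\<close> locally, and the chain rule gives \<open>v' = f(u)\<close>. At the
  exceptional point the square root may fail to be differentiable; there \<open>v\<close> is compared with an antiderivative of
  \<open>f(u)\<close>, from which it differs by a continuous function with zero derivative off one point.
\<close>

lemma second_derivative_of_energy_identity:
  fixes u v F f :: "real \<Rightarrow> real"
  assumes u: "\<And>x. (u has_real_derivative v x) (at x)" and v: "continuous_on UNIV v"
    and energy: "\<And>x. (v x)\<^sup>2 = F (u x)"
    and F: "\<And>x. (F has_real_derivative 2 * f (u x)) (at (u x))"
    and f: "continuous_on UNIV (\<lambda>x. f (u x))"
    and nz: "\<And>x. x \<noteq> a \<Longrightarrow> v x \<noteq> 0"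
  shows "(v has_real_derivative f (u x)) (at x)"
proof -
  have away: "(v has_real_derivative f (u x)) (at x)" if "x \<noteq> a" for x
  proof -
    have vx: "v x \<noteq> 0" using nz that by simp
    have Fx: "((\<lambda>y. F (u y)) has_real_derivative 2 * f (u x) * v x) (at x)"
      by (rule DERIV_chain2[OF F u])
    have pos: "F (u x) > 0" using energy[of x] vx by (metis zero_less_power2)
    have sq: "sqrt (F (u y)) = \<bar>v y\<bar>" for y using energy[of y] by (metis real_sqrt_abs)
    have "((\<lambda>y. sqrt (F (u y))) has_real_derivative inverse (sqrt (F (u x))) / 2 * (2 * f (u x) * v x)) (at x)"
      by (rule DERIV_chain2[OF DERIV_real_sqrt[OF pos] Fx])
    then have "((\<lambda>y. sgn (v x) * sqrt (F (u y))) has_real_derivative sgn (v x) * (inverse (sqrt (F (u x))) / 2 * (2 * f (u x) * v x))) (at x)"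
      by (rule DERIV_cmult)
    also have "sgn (v x) * (inverse (sqrt (F (u x))) / 2 * (2 * f (u x) * v x)) = f (u x)"
      using vx by (auto simp: sq sgn_if)
    finally have D: "((\<lambda>y. sgn (v x) * sqrt (F (u y))) has_real_derivative f (u x)) (at x)" .
    have ev: "\<forall>\<^sub>F y in nhds x. v y = sgn (v x) * sqrt (F (u y))"
    proof -
      have "isCont v x" using v by (simp add: continuous_on_eq_continuous_at)
      then have "\<forall>\<^sub>F y in nhds x. dist (v y) (v x) < \<bar>v x\<bar>"
        using vx by (auto simp: isCont_def tendsto_iff eventually_at_filter dest!: spec[of _ "\<bar>v x\<bar>"] elim: eventually_mono)
      then show ?thesis
        by eventually_elim (auto simp: sq sgn_if dist_real_def abs_if split: if_splits)
    qed
    show ?thesis by (rule iffD2[OF DERIV_cong_ev[OF refl ev refl] D])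
  qed
  from antiderivative_on_line[OF f]
  obtain W where W: "\<And>x. (W has_real_derivative f (u x)) (at x)"
    by blast
  have const: "v y - W y = v b - W b" if "b \<le> y" for b y
  proof (rule has_derivative_zero_unique_strong_interval[of "{a}" b y "\<lambda>x. v x - W x"])
    show "continuous_on {b..y} (\<lambda>x. v x - W x)"
      using v W by (auto intro!: continuous_intros intro: continuous_on_subset
          continuous_at_imp_continuous_on DERIV_isCont)
    show "((\<lambda>x. v x - W x) has_derivative (\<lambda>h. 0)) (at x within {b..y})" if "x \<in> {b..y} - {a}" for x
    proof -
      have "((\<lambda>x. v x - W x) has_real_derivative f (u x) - f (u x)) (at x)"
        using that by (intro derivative_intros away W) auto
      then have "((\<lambda>x. v x - W x) has_derivative (\<lambda>h. 0)) (at x)"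
        unfolding has_field_derivative_def by (rule has_derivative_eq_rhs) (simp add: fun_eq_iff)
      then show ?thesis by (rule has_derivative_at_withinI)
    qed
  qed (use that in auto)
  define K where "K = v 0 - W 0"
  have "v y = W y + K" for y using const[of 0 y] const[of y 0] by (cases "y \<ge> 0") (auto simp: K_def)
  then have "v = (\<lambda>y. W y + K)" by auto
  moreover have "((\<lambda>y. W y + K) has_real_derivative f (u x)) (at x)"
    by (auto intro!: derivative_eq_intros W)
  ultimately show ?thesis by simp
qed

text \<open>
  Otherwise \<open>u\<^sup>2\<close> would dominate a positive constant on a half-line, which has infinite measure.
\<close>

lemma square_integrable_small_values:
  fixes u :: "real \<Rightarrow> real"
  assumes "integrable lborel (\<lambda>x. (u x)\<^sup>2)" and "e > 0"
  shows "\<exists>x>a. \<bar>u x\<bar> < e" and "\<exists>x<a. \<bar>u x\<bar> < e"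
proof -
  have key: "\<exists>x\<in>A. \<bar>u x\<bar> < e" if A: "A \<in> sets lborel" "emeasure lborel A = \<infinity>" for A
  proof (rule ccontr)
    assume "\<not> ?thesis"
    then have ge: "e \<le> \<bar>u x\<bar>" if "x \<in> A" for x using that by force
    have "integrable lborel (\<lambda>x. (u x)\<^sup>2 / e\<^sup>2)" using assms(1) by simp
    then have "integrable lborel (indicator A :: real \<Rightarrow> real)"
    proof (rule Bochner_Integration.integrable_bound)
      have "norm (indicator A x :: real) \<le> norm ((u x)\<^sup>2 / e\<^sup>2)" for x
        using power_mono[OF ge[of x], of 2] \<open>e > 0\<close> by (cases "x \<in> A") auto
      then show "AE x in lborel. norm (indicator A x :: real) \<le> norm ((u x)\<^sup>2 / e\<^sup>2)" by simp
    qed (use A in simp)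
    then show False using A by (simp add: integrable_indicator_iff)
  qed
  have inf: "emeasure lborel A = \<infinity>"
    if I: "\<And>n. \<exists>b. {b<..b + real n} \<subseteq> A" and A: "A \<in> sets lborel" for A
  proof (rule ccontr)
    assume "emeasure lborel A \<noteq> \<infinity>"
    then have "emeasure lborel A < top" by (simp add: less_top)
    from ennreal_Ex_less_of_nat[OF this] obtain n where n: "emeasure lborel A < of_nat n" by blast
    obtain b where "{b<..b + real (Suc n)} \<subseteq> A" using I by blast
    then have "emeasure lborel {b<..b + real (Suc n)} \<le> emeasure lborel A" using A by (rule emeasure_mono)
    moreover have "emeasure lborel {b<..b + real (Suc n)} = ennreal (real (Suc n))" by simp
    ultimately have "ennreal (real (Suc n)) < ennreal (real n)"
      using n unfolding ennreal_of_nat_eq_real_of_nat by (metis le_less_trans)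
    then show False by (subst (asm) ennreal_less_iff) auto
  qed
  have "emeasure lborel {a<..} = \<infinity>" by (rule inf) (rule exI[of _ a], auto)
  moreover have "emeasure lborel {..<a} = \<infinity>"
    by (rule inf, rule_tac x = "a - real n - 1" in exI) auto
  ultimately   show "\<exists>x>a. \<bar>u x\<bar> < e" "\<exists>x<a. \<bar>u x\<bar> < e"
    using key[of "{a<..}"] key[of "{..<a}"] by auto
qed

text \<open>
  Once \<open>u\<close> is below \<open>\<delta>\<close> and decreasing (in one of the two directions of the line), it cannot turn, since at a
  minimum the slope would be zero; so it keeps decreasing with slope at least \<open>c\<close>.
\<close>

lemma steep_at_small_values_reaches_zero:
  fixes u v :: "real \<Rightarrow> real"
  assumes u: "\<And>x. (u has_real_derivative v x) (at x)"
    and steep: "\<And>x. u x < \<delta> \<Longrightarrow> c \<le> \<bar>v x\<bar>" and "c > 0" and x1: "u x1 < \<delta>"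
  shows "\<exists>x. u x \<le> 0"
proof -
  have forward: "\<exists>x. u x \<le> 0"
    if u: "\<And>x. (u has_real_derivative v x) (at x)" and steep: "\<And>x. u x < \<delta> \<Longrightarrow> c \<le> \<bar>v x\<bar>"
      and x1: "u x1 < \<delta>" "v x1 < 0" for u v and x1 :: real
  proof -
    have cu: "continuous_on S u" for S
      by (meson u DERIV_isCont continuous_at_imp_continuous_on)
    have neg: "v x < 0" if "x1 \<le> x" for x
    proof (rule ccontr)
      assume n: "\<not> v x < 0"
      then have lt: "x1 < x" using that x1 by (metis order_le_less)
      obtain y where y: "y \<in> {x1..x}" "\<And>t. t \<in> {x1..x} \<Longrightarrow> u y \<le> u t"
        using continuous_attains_inf[of "{x1..x}" u] cu lt by auto
      have "u y < \<delta>" using y(2)[of x1] lt x1 by simp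
      then have vy: "v y \<noteq> 0" using steep[of y] \<open>c > 0\<close> by auto
      consider "y = x1" | "y = x" | "x1 < y" "y < x" using y(1) by force
      then show False
      proof cases
        case 1
        obtain d where d: "d > 0" "\<And>h. 0 < h \<Longrightarrow> h < d \<Longrightarrow> u (x1 + h) < u x1"
          using DERIV_neg_dec_right[OF u x1(2)] by blast
        define h where "h = min (d/2) (x - x1)"
        have "0 < h" "h < d" "h \<le> x - x1" using d(1) lt by (auto simp: h_def)
        then show False using d(2)[of h] y(2)[of "x1 + h"] 1 by auto
      next
        case 2
        then have "v x > 0" using n vy by simp
        from DERIV_pos_inc_left[OF u this]
        obtain d where d: "d > 0" "\<And>h. 0 < h \<Longrightarrow> h < d \<Longrightarrow> u (x - h) < u x" by blast
        define h where "h = min (d/2) (x - x1)"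
        have "0 < h" "h < d" "h \<le> x - x1" using d(1) lt by (auto simp: h_def)
        then show False using d(2)[of h] y(2)[of "x - h"] 2 by auto
      next
        case 3
        have "v y = 0"
          by (rule DERIV_local_min[OF u, of "min (y - x1) (x - y)"])
            (use 3 y(2) in \<open>auto simp: abs_if min_def split: if_splits\<close>)
        then show False using vy by simp
      qed
    qed
    have dec: "u x \<le> u x1" if "x1 \<le> x" for x
      by (rule DERIV_nonpos_imp_nonincreasing[OF that]) (use u neg in \<open>meson less_imp_le\<close>)
    have slope: "v x \<le> - c" if "x1 \<le> x" for x
      using steep[of x] dec[OF that] x1 neg[OF that] by auto
    have "u x + c * x \<le> u x1 + c * x1" if "x1 \<le> x" for x
    proof (rule DERIV_nonpos_imp_nonincreasing[OF that])
      fix y assume "x1 \<le> y" "y \<le> x"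
      moreover have "((\<lambda>x. u x + c * x) has_real_derivative v y + c) (at y)"
        by (auto intro!: derivative_eq_intros u)
      ultimately show "\<exists>d. ((\<lambda>x. u x + c * x) has_real_derivative d) (at y) \<and> d \<le> 0"
        using slope[of y] by auto
    qed
    from this[of "x1 + \<bar>u x1\<bar> / c"] have "u (x1 + \<bar>u x1\<bar> / c) \<le> u x1 - \<bar>u x1\<bar>"
      using \<open>c > 0\<close> by (simp add: algebra_simps)
    then show ?thesis by (intro exI[of _ "x1 + \<bar>u x1\<bar> / c"]) auto
  qed
  have "v x1 \<noteq> 0" using steep[OF x1] \<open>c > 0\<close> by auto
  then consider "v x1 < 0" | "v x1 > 0" by linarith
  then show ?thesis
  proof cases
    case 1 then show ?thesis using forward[OF u steep x1] by blast
  next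
    case 2
    have "\<exists>x. u (- x) \<le> 0"
    proof (rule forward[of "\<lambda>x. u (- x)" "\<lambda>x. - v (- x)" "- x1"])
      show "((\<lambda>x. u (- x)) has_real_derivative - v (- x)) (at x)" for x
        using u[of "- x"] by (simp add: DERIV_mirror)
    qed (use 2 x1 steep in auto)
    then show ?thesis by blast
  qed
qed

section \<open>Homoclinic orbits of \<open>u'' = f(u)\<close>\<close>

text \<open>
  The energy of \<open>u'' = f(u)\<close> at level zero reads \<open>u'\<^sup>2 = u\<^sup>2 G(u)\<close>. Factoring out \<open>u\<^sup>2\<close> separates the
  hyperbolic rest point \<open>0\<close>, where \<open>G > 0\<close>, from the turning point \<open>s0\<close>. The condition \<open>f s0 < 0\<close> says
  that the zero \<open>s0\<close> of \<open>G\<close> is simple.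
\<close>

locale homoclinic_profile =
  fixes G f f' :: "real \<Rightarrow> real" and s0 :: real
  assumes s0: "s0 > 0"
    and G_cont: "continuous_on {0..} G"
    and G_pos: "\<And>s. 0 \<le> s \<Longrightarrow> s < s0 \<Longrightarrow> G s > 0"
    and G_s0: "G s0 = 0"
    and G_neg: "\<And>s. s > s0 \<Longrightarrow> G s < 0"
    and F_deriv: "\<And>s. s > 0 \<Longrightarrow> ((\<lambda>s. s\<^sup>2 * G s) has_real_derivative 2 * f s) (at s)"
    and f_deriv: "\<And>s. s > 0 \<Longrightarrow> (f has_real_derivative f' s) (at s)"
    and f'_cont: "continuous_on {0<..} f'"
    and f_s0: "f s0 < 0"
begin

lemma G_deriv:
  assumes "s > 0"
  shows "(G has_real_derivative (2 * f s / s\<^sup>2 - 2 * G s / s)) (at s)"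
proof (rule has_field_derivative_transform_within_open[of "\<lambda>s. (s\<^sup>2 * G s) / s\<^sup>2" _ s "{0<..}"])
  have "((\<lambda>s. (s\<^sup>2 * G s) / s\<^sup>2) has_real_derivative
      (2 * f s * s\<^sup>2 - s\<^sup>2 * G s * (2 * s)) / (s\<^sup>2 * s\<^sup>2)) (at s)"
    using assms by (intro DERIV_divide F_deriv) (auto intro!: derivative_eq_intros)
  also have "(2 * f s * s\<^sup>2 - s\<^sup>2 * G s * (2 * s)) / (s\<^sup>2 * s\<^sup>2) = 2 * f s / s\<^sup>2 - 2 * G s / s"
    using assms by (simp add: field_simps power2_eq_square)
  finally show "((\<lambda>s. (s\<^sup>2 * G s) / s\<^sup>2) has_real_derivative (2 * f s / s\<^sup>2 - 2 * G s / s)) (at s)" .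
qed (use assms in auto)

lemma G_bounded: obtains M where "M > 0" "\<And>s. 0 \<le> s \<Longrightarrow> s \<le> s0 \<Longrightarrow> G s \<le> M"
proof -
  have "\<exists>x\<in>{0..s0}. \<forall>y\<in>{0..s0}. G y \<le> G x"
    by (rule continuous_attains_sup) (use s0 G_cont in \<open>auto intro: continuous_on_subset\<close>)
  then obtain x where x: "x \<in> {0..s0}" "\<forall>y\<in>{0..s0}. G y \<le> G x" by blast
  have "G 0 \<le> G x" using x s0 by auto
  then have "G x > 0" using G_pos[of 0] s0 by linarith
  then show ?thesis using that[of "G x"] x by auto
qed

text \<open>
  The right-hand side for \<open>z\<close> under the substitution \<open>u = s0 * exp (- z\<^sup>2)\<close>, that is the square root of
  \<open>G(u) / (4 z\<^sup>2)\<close>. The value at \<open>0\<close> is the limit: the derivative of \<open>w \<mapsto> G (s0 * exp (- w))\<close>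
  at \<open>0\<close> is \<open>- s0 * G'(s0) = - 2 * f s0 / s0\<close>.
\<close>

definition speed :: "real \<Rightarrow> real" where
  "speed z = sqrt (if z = 0 then - f s0 / (2 * s0) else G (s0 * exp (- z\<^sup>2)) / (4 * z\<^sup>2))"

lemma below_s0: "z \<noteq> 0 \<Longrightarrow> s0 * exp (- z\<^sup>2) < s0" for z :: real
  using s0 by simp

lemma speed_pos: "speed z > 0"
proof (cases "z = 0")
  case True
  then show ?thesis using s0 f_s0 by (simp add: speed_def divide_neg_pos)
next
  case False
  then show ?thesis using G_pos[OF _ below_s0[OF False]] s0 by (simp add: speed_def)
qed

lemma speed_sq: "4 * z\<^sup>2 * (speed z)\<^sup>2 = G (s0 * exp (- z\<^sup>2))"
proof (cases "z = 0")
  case True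
  then show ?thesis using G_s0 by simp
next
  case False
  then show ?thesis using G_pos[OF _ below_s0[OF False]] s0 by (simp add: speed_def)
qed

lemma speed_cont: "continuous_on UNIV speed"
proof -
  have D: "((\<lambda>w. G (s0 * exp (- w))) has_real_derivative
      (2 * f (s0 * exp (- w)) / (s0 * exp (- w))\<^sup>2 - 2 * G (s0 * exp (- w)) / (s0 * exp (- w))) * (- (s0 * exp (- w)))) (at w)" for w
    by (rule DERIV_chain2[OF G_deriv]) (use s0 in \<open>auto intro!: derivative_eq_intros\<close>)
  have "isCont speed z" for z
  proof (cases "z = 0")
    case True
    have "((\<lambda>h. (G (s0 * exp (- (0 + h))) - G (s0 * exp (- 0))) / h) \<longlongrightarrow> - 2 * f s0 / s0) (at 0)"
      using D[of 0] s0 G_s0 unfolding DERIV_def by (simp add: power2_eq_square)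
    then have "((\<lambda>h. G (s0 * exp (- h)) / h) \<longlongrightarrow> - 2 * f s0 / s0) (at 0)"
      by (simp add: G_s0)
    moreover have "filterlim (\<lambda>z::real. z\<^sup>2) (at 0) (at 0)"
      unfolding filterlim_at by (auto intro!: tendsto_eq_intros simp: eventually_at_filter)
    ultimately have "((\<lambda>z. G (s0 * exp (- z\<^sup>2)) / z\<^sup>2) \<longlongrightarrow> - 2 * f s0 / s0) (at 0)"
      by (rule filterlim_compose)
    from tendsto_divide[OF this tendsto_const[of 4]]
    have "((\<lambda>z. sqrt (G (s0 * exp (- z\<^sup>2)) / (4 * z\<^sup>2))) \<longlongrightarrow> speed 0) (at 0)"
      by (auto intro!: tendsto_real_sqrt simp: speed_def mult.commute)
    then have "(speed \<longlongrightarrow> speed 0) (at 0)"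
      by (rule Lim_transform_eventually) (auto simp: eventually_at_filter speed_def)
    then show ?thesis using True by (simp add: isCont_def)
  next
    case False
    have "isCont (\<lambda>w. G (s0 * exp (- w))) (z\<^sup>2)" using D DERIV_isCont by blast
    then have "isCont (\<lambda>z. G (s0 * exp (- z\<^sup>2))) z"
      by (rule isCont_o2[rotated]) auto
    then have "isCont (\<lambda>z. sqrt (G (s0 * exp (- z\<^sup>2)) / (4 * z\<^sup>2))) z"
      using False by (intro continuous_intros) auto
    moreover have "\<forall>\<^sub>F y in nhds z. speed y = sqrt (G (s0 * exp (- y\<^sup>2)) / (4 * y\<^sup>2))"
      using t1_space_nhds[OF False] by eventually_elim (simp add: speed_def)
    ultimately show ?thesis by (simp add: isCont_cong)
  qed
  then show ?thesis by (simp add: continuous_on_eq_continuous_at)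
qed

lemma speed_bounded: "\<exists>B. \<forall>z. speed z \<le> B"
proof -
  obtain M where M: "M > 0" "\<And>s. 0 \<le> s \<Longrightarrow> s \<le> s0 \<Longrightarrow> G s \<le> M"
    using G_bounded by blast
  obtain x where x: "\<forall>y\<in>{-1..1}. speed y \<le> speed x"
    using continuous_attains_sup[OF compact_Icc _ continuous_on_subset[OF speed_cont subset_UNIV], of "-1" 1] by auto
  have "speed z \<le> max (speed x) (sqrt M)" for z
  proof (cases "z \<in> {-1..1}")
    case True
    then show ?thesis using x by (auto simp: le_max_iff_disj)
  next
    case False
    then have z: "\<bar>z\<bar> > 1" "z \<noteq> 0" by auto
    then have "z\<^sup>2 \<ge> 1" using one_le_power[of "\<bar>z\<bar>" 2] by simp
    then have "G (s0 * exp (- z\<^sup>2)) / (4 * z\<^sup>2) \<le> M / 1"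
      using M below_s0[OF z(2)] s0 G_pos[OF _ below_s0[OF z(2)]] by (intro frac_le) auto
    then show ?thesis using z by (auto simp: speed_def le_max_iff_disj)
  qed
  then show ?thesis by blast
qed

definition solution :: "(real \<Rightarrow> real) \<Rightarrow> (real \<Rightarrow> real) \<Rightarrow> bool" where
  "solution u v \<longleftrightarrow> (\<forall>x. u x > 0 \<and> (u has_real_derivative v x) (at x) \<and>
     (v has_real_derivative f (u x)) (at x))"

lemma solution_shift: "solution u v \<Longrightarrow> solution (\<lambda>x. u (x + a)) (\<lambda>x. v (x + a))"
  unfolding solution_def by (auto simp: DERIV_shift[symmetric])

lemma solution_reflect: "solution u v \<Longrightarrow> solution (\<lambda>x. u (- x)) (\<lambda>x. - v (- x))"
  unfolding solution_def
proof (intro allI conjI)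
  fix x assume *: "\<forall>x. u x > 0 \<and> (u has_real_derivative v x) (at x) \<and> (v has_real_derivative f (u x)) (at x)"
  then show "u (- x) > 0" by blast
  show "((\<lambda>x. u (- x)) has_real_derivative - v (- x)) (at x)"
    using * by (subst DERIV_mirror[symmetric]) simp
  have "((\<lambda>x. v (- x)) has_real_derivative - f (u (- x))) (at x)"
    using * by (subst DERIV_mirror[symmetric]) simp
  from DERIV_minus[OF this] show "((\<lambda>x. - v (- x)) has_real_derivative f (u (- x))) (at x)" by simp
qed

text \<open>
  On \<open>[1, \<infinity>)\<close> the values of \<open>u\<close> stay below \<open>u 1 < s0\<close>, where \<open>G\<close> has a positive minimum \<open>c\<^sup>2\<close>. Hence
  \<open>u' \<le> - c u\<close> there. The factor \<open>exp c\<close> in the final constant covers \<open>[0, 1]\<close>.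
\<close>

lemma half_line_decay:
  assumes pos: "\<And>x. u x > 0" and u: "\<And>x. (u has_real_derivative v x) (at x)"
    and energy: "\<And>x. (v x)\<^sup>2 = (u x)\<^sup>2 * G (u x)" and neg: "\<And>x. x > 0 \<Longrightarrow> v x < 0"
  obtains C c where "c > 0" "\<And>x. x \<ge> 0 \<Longrightarrow> u x \<le> C * exp (- c * x)"
proof -
  have le: "u x \<le> s0" for x
  proof (rule ccontr)
    assume "\<not> u x \<le> s0"
    then have "(u x)\<^sup>2 * G (u x) < 0" using G_neg[of "u x"] pos[of x] by (simp add: mult_pos_neg)
    then show False using energy[of x] by (metis not_less zero_le_power2)
  qed
  have "u 1 \<noteq> s0" using energy[of 1] neg[of 1] G_s0 by auto
  then have u1: "u 1 < s0" using le[of 1] by simp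
  have "\<exists>x\<in>{0..u 1}. \<forall>y\<in>{0..u 1}. G x \<le> G y"
    by (rule continuous_attains_inf) (use pos[of 1] G_cont in \<open>auto intro: continuous_on_subset\<close>)
  then obtain m where m: "m \<in> {0..u 1}" "\<And>y. y \<in> {0..u 1} \<Longrightarrow> G m \<le> G y" by blast
  have Gm: "G m > 0" using m u1 by (intro G_pos) auto
  define c where "c = sqrt (G m)"
  have c: "c > 0" using Gm by (simp add: c_def)
  have dec: "u x \<le> u 1" if "x \<ge> 1" for x
  proof (rule DERIV_nonpos_imp_nonincreasing[OF that])
    show "\<exists>d. (u has_real_derivative d) (at y) \<and> d \<le> 0" if "1 \<le> y" for y
      using u[of y] neg[of y] that by (intro exI[of _ "v y"]) auto
  qed
  have slope: "v x \<le> - c * u x" if "x \<ge> 1" for x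
  proof -
    have "(c * u x)\<^sup>2 \<le> (v x)\<^sup>2"
      using m(2)[of "u x"] dec[OF that] pos[of x] Gm
      by (simp add: energy c_def power_mult_distrib mult.commute)
    then have "c * u x \<le> \<bar>v x\<bar>" using abs_le_square_iff[of "c * u x" "v x"] by linarith
    then show ?thesis using neg[of x] that by simp
  qed
  have "u x \<le> s0 * exp c * exp (- c * x)" if "x \<ge> 0" for x
  proof (cases "x \<ge> 1")
    case True
    have "u x \<le> u 1 * exp (- c * (x - 1))"
      by (rule exp_decay_of_derivative_bound[OF True u]) (use slope in auto)
    also have "\<dots> \<le> s0 * exp (- c * (x - 1))" using le[of 1] by simp
    also have "\<dots> = s0 * exp c * exp (- c * x)"
      by (simp add: mult.assoc algebra_simps flip: exp_add)
    finally show ?thesis .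
  next
    case False
    have "s0 * 1 \<le> s0 * exp (c + (- c * x))"
      using s0 c False that by (intro mult_left_mono) (auto simp: mult_le_cancel_left1)
    also have "s0 * exp (c + (- c * x)) = s0 * exp c * exp (- c * x)"
      unfolding exp_add by (simp only: mult.assoc)
    finally show ?thesis using le[of x] by simp
  qed
  then show ?thesis using that c by blast
qed

proposition homoclinic_solution:
  obtains u v C c where "solution u v" "u 0 = s0" "v 0 = 0" "\<And>x. (v x)\<^sup>2 = (u x)\<^sup>2 * G (u x)"
    "c > 0" "\<And>x. u x \<le> C * exp (- c * \<bar>x\<bar>)" "\<And>x. \<bar>v x\<bar> \<le> C * exp (- c * \<bar>x\<bar>)"
proof -
  obtain B where B: "\<And>z. speed z \<le> B" using speed_bounded by auto
  from autonomous_global_solution[OF speed_cont speed_pos B]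
  obtain z where z0: "z 0 = 0" and z: "\<And>x. (z has_real_derivative speed (z x)) (at x)" by auto
  have z_less: "z x < z y" if "x < y" for x y
  proof (rule DERIV_pos_imp_increasing[OF that])
    show "\<exists>d. (z has_real_derivative d) (at t) \<and> 0 < d" for t
      using z[of t] speed_pos[of "z t"] by (intro exI conjI)
  qed
  define u where "u x = s0 * exp (- (z x)\<^sup>2)" for x
  define v where "v x = - (2 * z x * speed (z x)) * u x" for x
  have pos: "u x > 0" for x using s0 by (simp add: u_def)
  have u: "(u has_real_derivative v x) (at x)" for x
  proof -
    have "((\<lambda>x. s0 * exp (- (z x)\<^sup>2)) has_real_derivative
        s0 * (exp (- (z x)\<^sup>2) * - (2 * z x * speed (z x)))) (at x)"
      by (intro DERIV_cmult DERIV_chain2[OF DERIV_exp] DERIV_minus) (auto intro!: derivative_eq_intros z)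
    then show ?thesis by (simp add: u_def[abs_def] v_def mult_ac)
  qed
  have energy: "(v x)\<^sup>2 = (u x)\<^sup>2 * G (u x)" for x
    using speed_sq[of "z x"] by (simp add: v_def u_def power_mult_distrib mult_ac)
  have cz: "continuous_on S z" for S
    by (meson z DERIV_isCont continuous_at_imp_continuous_on)
  have cu: "continuous_on S u" for S
    by (meson u DERIV_isCont continuous_at_imp_continuous_on)
  have cv: "continuous_on UNIV v"
    unfolding v_def[abs_def]
    by (intro continuous_intros cu cz continuous_on_compose2[OF speed_cont cz]) auto
  have sign: "v x < 0" if "x > 0" for x
    using z_less[OF that] z0 speed_pos[of "z x"] pos[of x] by (simp add: v_def)
  have sign': "v x > 0" if "x < 0" for x
    using z_less[OF that] z0 speed_pos[of "z x"] pos[of x] by (simp add: v_def mult_neg_pos mult_pos_neg)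
  have fc: "continuous_on UNIV (\<lambda>x. f (u x))"
  proof (rule continuous_on_compose2[of "{0<..}" f])
    show "continuous_on {0<..} f"
      by (rule continuous_at_imp_continuous_on) (auto intro: DERIV_isCont f_deriv)
  qed (use cu pos in auto)
  have v: "(v has_real_derivative f (u x)) (at x)" for x
    by (rule second_derivative_of_energy_identity[OF u cv, of "\<lambda>s. s\<^sup>2 * G s" f 0])
      (use energy F_deriv pos fc sign sign' in \<open>auto simp: neq_iff\<close>)
  have sol: "solution u v" using pos u v by (simp add: solution_def)
  obtain C1 c1 where c1: "c1 > 0" "\<And>x. x \<ge> 0 \<Longrightarrow> u x \<le> C1 * exp (- c1 * x)"
    using half_line_decay[OF pos u energy sign] by blast
  obtain C2 c2 where c2: "c2 > 0" "\<And>x. x \<ge> 0 \<Longrightarrow> u (- x) \<le> C2 * exp (- c2 * x)"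
  proof (rule half_line_decay[of "\<lambda>x. u (- x)" "\<lambda>x. - v (- x)"])
    show "((\<lambda>x. u (- x)) has_real_derivative - v (- x)) (at x)" for x
      using solution_reflect[OF sol] by (simp add: solution_def)
  qed (use pos energy sign' in auto)
  obtain M where M: "M > 0" "\<And>s. 0 \<le> s \<Longrightarrow> s \<le> s0 \<Longrightarrow> G s \<le> M"
    using G_bounded by blast
  define c where "c = min c1 c2"
  define C where "C = max C1 C2"
  have "C1 > 0" "C2 > 0"
    using c1(2)[of 0] c2(2)[of 0] pos[of 0] by auto
  then have C: "C > 0" by (simp add: C_def)
  have bound: "u x \<le> C * exp (- c * \<bar>x\<bar>)" for x
  proof (cases "x \<ge> 0")
    case True
    have "u x \<le> C1 * exp (- c1 * x)" using c1 True by blast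
    also have "\<dots> \<le> C * exp (- c * \<bar>x\<bar>)"
      using True \<open>C1 > 0\<close> by (intro mult_mono) (auto simp: C_def c_def mult_right_mono)
    finally show ?thesis .
  next
    case False
    have "u x \<le> C2 * exp (- c2 * (- x))" using c2(2)[of "- x"] False by simp
    also have "\<dots> \<le> C * exp (- c * \<bar>x\<bar>)"
      using False \<open>C2 > 0\<close> by (intro mult_mono) (auto simp: C_def c_def mult_right_mono_neg)
    finally show ?thesis .
  qed
  have vb: "\<bar>v x\<bar> \<le> sqrt M * u x" for x
  proof -
    have "u x \<le> s0" using s0 by (simp add: u_def)
    then have "(v x)\<^sup>2 \<le> (sqrt M * u x)\<^sup>2"
      using M pos[of x] by (simp add: energy power_mult_distrib mult.commute)
    then show ?thesis using M pos[of x] using abs_le_square_iff[of "v x" "sqrt M * u x"] by simp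
  qed
  \<comment> \<open>one constant for \<open>u\<close> and for \<open>v\<close>, since \<open>\<bar>v\<bar> \<le> sqrt M * u\<close>\<close>
  define D where "D = max 1 (sqrt M) * C"
  have "u x \<le> D * exp (- c * \<bar>x\<bar>)" for x
  proof -
    have "1 * C \<le> D" unfolding D_def using C by (intro mult_right_mono) auto
    then have "C * exp (- c * \<bar>x\<bar>) \<le> D * exp (- c * \<bar>x\<bar>)" by (intro mult_right_mono) auto
    then show ?thesis using bound[of x] by linarith
  qed
  moreover have "\<bar>v x\<bar> \<le> D * exp (- c * \<bar>x\<bar>)" for x
  proof -
    have "\<bar>v x\<bar> \<le> sqrt M * u x" by (rule vb)
    also have "\<dots> \<le> max 1 (sqrt M) * (C * exp (- c * \<bar>x\<bar>))"
      using pos[of x] bound[of x] by (intro mult_mono) auto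
    finally show ?thesis by (simp add: D_def mult.assoc)
  qed
  moreover have "c > 0" using c1 c2 by (simp add: c_def)
  moreover have "u 0 = s0" "v 0 = 0" using z0 by (auto simp: u_def v_def)
  ultimately show ?thesis using that[of u v c D] sol energy by blast
qed

text \<open>
  Uniqueness for the initial value problem on \<open>[0, T]\<close>. Both solutions stay in a compact interval of positive
  numbers, on which \<open>f\<close> is Lipschitz, and the squared distance in the phase plane obeys a Gronwall inequality.
\<close>

lemma solutions_agree_forward:
  assumes uv: "solution u v" and wy: "solution w y" and "u 0 = w 0" "v 0 = y 0" and T: "T \<ge> 0"
  shows "u T = w T"
proof -
  have sol: "u x > 0" "w x > 0" "(u has_real_derivative v x) (at x)" "(w has_real_derivative y x) (at x)"
    "(v has_real_derivative f (u x)) (at x)" "(y has_real_derivative f (w x)) (at x)" for x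
    using uv wy by (auto simp: solution_def)
  have cont: "continuous_on S u" "continuous_on S w" for S
    by (meson sol(3,4) DERIV_isCont continuous_at_imp_continuous_on)+
  have "{0..T} \<noteq> {}" using T by simp
  note ex = continuous_attains_inf[OF compact_Icc this] continuous_attains_sup[OF compact_Icc this]
  from ex(1)[OF cont(1)] obtain a1 where a1: "\<And>x. x \<in> {0..T} \<Longrightarrow> u a1 \<le> u x" by blast
  from ex(2)[OF cont(1)] obtain b1 where b1: "\<And>x. x \<in> {0..T} \<Longrightarrow> u x \<le> u b1" by blast
  from ex(1)[OF cont(2)] obtain a2 where a2: "\<And>x. x \<in> {0..T} \<Longrightarrow> w a2 \<le> w x" by blast
  from ex(2)[OF cont(2)] obtain b2 where b2: "\<And>x. x \<in> {0..T} \<Longrightarrow> w x \<le> w b2" by blast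
  define a where "a = min (u a1) (w a2)"
  define b where "b = max (u b1) (w b2)"
  have a: "a > 0" by (simp add: a_def sol)
  have mem: "u x \<in> {a..b}" "w x \<in> {a..b}" if "x \<in> {0..T}" for x
    using a1[OF that] b1[OF that] a2[OF that] b2[OF that] by (auto simp: a_def b_def)
  have ab: "{a..b} \<noteq> {}" using mem(1)[of 0] T by auto
  have "continuous_on {a..b} f'" by (rule continuous_on_subset[OF f'_cont]) (use a in auto)
  then have "bounded (f' ` {a..b})"
    by (intro compact_imp_bounded compact_continuous_image compact_Icc)
  then obtain L where L: "L > 0" "\<forall>d\<in>f' ` {a..b}. norm d \<le> L"
    unfolding bounded_pos by blast
  have lip: "\<bar>f s - f t\<bar> \<le> L * \<bar>s - t\<bar>" if st: "s \<in> {a..b}" "t \<in> {a..b}" for s t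
  proof -
    have "norm (f s - f t) \<le> L * norm (s - t)"
    proof (rule field_differentiable_bound[OF convex_real_interval(5) _ _ st])
      show "(f has_field_derivative f' z) (at z within {a..b})" if "z \<in> {a..b}" for z
        by (rule has_field_derivative_at_within[OF f_deriv]) (use that a in auto)
      show "norm (f' z) \<le> L" if "z \<in> {a..b}" for z
        using L(2) that by blast
    qed
    then show ?thesis by simp
  qed
  define e where "e x = (u x - w x)\<^sup>2 + (v x - y x)\<^sup>2" for x
  have "e T \<le> e 0 * exp (- (- (1 + L)) * (T - 0))"
  proof (rule exp_decay_of_derivative_bound[OF T])
    fix x assume x: "0 \<le> x" "x \<le> T"
    show "(e has_real_derivative 2 * (u x - w x) * (v x - y x) + 2 * (v x - y x) * (f (u x) - f (w x))) (at x)"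
      unfolding e_def[abs_def]
      by (rule derivative_eq_intros sol refl)+ (simp add: algebra_simps)
    let ?p = "\<bar>u x - w x\<bar>" and ?q = "\<bar>v x - y x\<bar>"
    have "2 * (u x - w x) * (v x - y x) \<le> 2 * (?p * ?q)"
      using abs_ge_self[of "(u x - w x) * (v x - y x)"] unfolding abs_mult mult.assoc by linarith
    moreover have "2 * (v x - y x) * (f (u x) - f (w x)) \<le> 2 * (?q * (L * ?p))"
    proof -
      have "(v x - y x) * (f (u x) - f (w x)) \<le> ?q * \<bar>f (u x) - f (w x)\<bar>"
        using abs_ge_self[of "(v x - y x) * (f (u x) - f (w x))"] by (simp add: abs_mult)
      also have "\<dots> \<le> ?q * (L * ?p)" by (rule mult_left_mono[OF lip]) (use mem x in auto)
      finally show ?thesis unfolding mult.assoc by linarith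
    qed
    moreover have "(1 + L) * (2 * (?p * ?q)) \<le> (1 + L) * e x"
    proof (rule mult_left_mono)
      show "2 * (?p * ?q) \<le> e x"
        using sum_squares_bound[of ?p ?q] by (simp add: e_def mult.assoc)
    qed (use L(1) in simp)
    moreover have "2 * (?p * ?q) + 2 * (?q * (L * ?p)) = (1 + L) * (2 * (?p * ?q))"
      by (simp only: distrib_right mult_1_left) (simp only: mult_ac)
    ultimately show "2 * (u x - w x) * (v x - y x) + 2 * (v x - y x) * (f (u x) - f (w x)) \<le> - (- (1 + L)) * e x"
      by (simp only: minus_minus)
  qed
  moreover have "e 0 = 0" using assms by (simp add: e_def)
  ultimately have "e T \<le> 0" by simp
  then show ?thesis by (simp add: e_def sum_power2_le_zero_iff)
qed

lemma solutions_agree: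
  assumes uv: "solution u v" and wy: "solution w y" and 0: "u 0 = w 0" "v 0 = y 0"
  shows "u x = w x"
proof (cases "x \<ge> 0")
  case True
  then show ?thesis using solutions_agree_forward assms by blast
next
  case False
  then show ?thesis
    using solutions_agree_forward[OF solution_reflect[OF uv] solution_reflect[OF wy], of "- x"] 0 by simp
qed

text \<open>
  The energy is a constant \<open>E\<close>. Evaluated where \<open>u\<close> is tiny, \<open>E < 0\<close> would make \<open>v\<^sup>2\<close> negative. If
  \<open>E > 0\<close>, then \<open>\<bar>v\<bar>\<close> is bounded below wherever \<open>u\<close> is small, and \<open>u\<close> would reach zero.
\<close>

lemma square_integrable_solution_energy:
  assumes uv: "solution u v" and L2: "integrable lborel (\<lambda>x. (u x)\<^sup>2)"
  shows "(v x)\<^sup>2 = (u x)\<^sup>2 * G (u x)"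
proof -
  have pos: "u x > 0" and u: "(u has_real_derivative v x) (at x)"
    and v: "(v has_real_derivative f (u x)) (at x)" for x
    using uv by (auto simp: solution_def)
  define F where "F s = s\<^sup>2 * G s" for s
  define E where "E = (v 0)\<^sup>2 - F (u 0)"
  have "((\<lambda>x. (v x)\<^sup>2 - F (u x)) has_real_derivative 0) (at x)" for x
  proof -
    have "((\<lambda>x. F (u x)) has_real_derivative 2 * f (u x) * v x) (at x)"
      unfolding F_def by (rule DERIV_chain2[OF F_deriv[OF pos] u])
    then show ?thesis by (auto intro!: derivative_eq_intros v)
  qed
  then have E: "(v x)\<^sup>2 = F (u x) + E" for x
    using DERIV_isconst_all[of "\<lambda>x. (v x)\<^sup>2 - F (u x)" x 0] by (simp add: E_def)
  have small: "\<exists>\<delta>>0. \<forall>s. 0 < s \<and> s < \<delta> \<longrightarrow> \<bar>F s\<bar> < e" if "e > 0" for e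
  proof -
    have "continuous_on {0..} F" unfolding F_def[abs_def] by (intro continuous_intros G_cont)
    from this[unfolded continuous_on_iff, rule_format, of 0 e]
    obtain \<delta> where "\<delta> > 0" "\<And>s. s \<in> {0..} \<Longrightarrow> dist s 0 < \<delta> \<Longrightarrow> dist (F s) (F 0) < e"
      using \<open>e > 0\<close> by auto
    then show ?thesis by (intro exI[of _ \<delta>]) (auto simp: F_def)
  qed
  have inf: "\<exists>x. u x < \<delta>" if "\<delta> > 0" for \<delta>
    using square_integrable_small_values(1)[OF L2 that] by (auto simp: abs_less_iff)
  have "\<not> E < 0"
  proof
    assume "E < 0"
    then obtain \<delta> where d: "\<delta> > 0" "\<And>s. 0 < s \<Longrightarrow> s < \<delta> \<Longrightarrow> \<bar>F s\<bar> < - E" using small[of "- E"] by auto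
    obtain x where "u x < \<delta>" using inf d by blast
    then have "F (u x) + E < 0" using d(2)[of "u x"] pos[of x] by auto
    then show False using E[of x] by (metis not_less zero_le_power2)
  qed
  moreover have "\<not> E > 0"
  proof
    assume "E > 0"
    then obtain \<delta> where d: "\<delta> > 0" "\<And>s. 0 < s \<Longrightarrow> s < \<delta> \<Longrightarrow> \<bar>F s\<bar> < E / 2" using small[of "E / 2"] by auto
    obtain x1 where x1: "u x1 < \<delta>" using inf d by blast
    have "sqrt (E / 2) \<le> \<bar>v x\<bar>" if "u x < \<delta>" for x
    proof -
      have "E / 2 \<le> (v x)\<^sup>2" using d(2)[OF pos that] E[of x] by (simp add: abs_if split: if_splits)
      then show ?thesis by (metis real_sqrt_abs real_sqrt_le_mono)
    qed
    from steep_at_small_values_reaches_zero[OF u this _ x1] \<open>E > 0\<close>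
    obtain x where "u x \<le> 0" by auto
    then show False using pos[of x] by simp
  qed
  ultimately show ?thesis using E[of x] by (simp add: F_def)
qed

text \<open>
  On either side of \<open>0\<close> there is a value below \<open>u 0\<close>, so there is an interior maximum, and the energy relation
  leaves \<open>s0\<close> as the only possible maximal value.
\<close>

lemma square_integrable_solution_turns:
  assumes uv: "solution u v" and L2: "integrable lborel (\<lambda>x. (u x)\<^sup>2)"
  obtains x0 where "u x0 = s0" "v x0 = 0"
proof -
  have pos: "u x > 0" and u: "(u has_real_derivative v x) (at x)" for x
    using uv by (auto simp: solution_def)
  obtain x2 where x2: "x2 > 0" "u x2 < u 0"
    using square_integrable_small_values(1)[OF L2, of "u 0" 0] pos[of 0] by (auto simp: abs_less_iff)
  obtain x1 where x1: "x1 < 0" "u x1 < u 0"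
    using square_integrable_small_values(2)[OF L2, of "u 0" 0] pos[of 0] by (auto simp: abs_less_iff)
  have c: "continuous_on {x1..x2} u" by (meson u DERIV_isCont continuous_at_imp_continuous_on)
  have "{x1..x2} \<noteq> {}" using x1 x2 by simp
  from continuous_attains_sup[OF compact_Icc this c]
  obtain y where y: "y \<in> {x1..x2}" "\<And>t. t \<in> {x1..x2} \<Longrightarrow> u t \<le> u y"
    by blast
  have "u 0 \<le> u y" using y x1 x2 by auto
  then have in_y: "x1 < y" "y < x2" using y(1) x1 x2 by (auto simp: order_le_less)
  have vy: "v y = 0"
    by (rule DERIV_local_max[OF u, of "min (y - x1) (x2 - y)"])
      (use in_y y(2) in \<open>auto simp: abs_if split: if_splits\<close>)
  then have "G (u y) = 0" using square_integrable_solution_energy[OF uv L2, of y] pos[of y] by auto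
  then have "u y = s0" using G_pos[of "u y"] G_neg[of "u y"] pos[of y] by (cases "u y" s0 rule: linorder_cases) auto
  then show ?thesis using that vy by blast
qed

proposition square_integrable_solution_unique:
  assumes uv: "solution u v" and "u 0 = s0" "v 0 = 0"
    and wy: "solution w y" and L2: "integrable lborel (\<lambda>x. (w x)\<^sup>2)"
  shows "\<exists>a. \<forall>x. w x = u (x + a)"
proof -
  obtain x0 where x0: "w x0 = s0" "y x0 = 0" by (rule square_integrable_solution_turns[OF wy L2])
  have "w (x + x0) = u x" for x
    by (rule solutions_agree[OF solution_shift[OF wy] uv]) (use x0 assms in auto)
  from this[of "_ - x0"] show ?thesis by (intro exI[of _ "- x0"]) auto
qed

end

section \<open>The bound-state of the nonlinear Schroedinger equation\<close>

text \<open>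
  The square of \<open>\<psi>' / \<psi>\<close> as a function of the value \<open>s\<close> of the bound-state \<open>\<psi>\<close>, as dictated by zero energy.
\<close>

definition nls_log_slope_sq :: "real \<Rightarrow> real \<Rightarrow> real \<Rightarrow> real \<Rightarrow> real \<Rightarrow> real \<Rightarrow> real \<Rightarrow> real" where
  "nls_log_slope_sq \<epsilon> \<eta>1 \<eta>2 \<sigma>1 \<sigma>2 c s =
     \<epsilon> - 2 * \<eta>1 / (\<sigma>1 + 2) * s powr \<sigma>1 - c * (2 * \<eta>2 / (\<sigma>2 + 2)) * s powr \<sigma>2"

definition nls_force :: "real \<Rightarrow> real \<Rightarrow> real \<Rightarrow> real \<Rightarrow> real \<Rightarrow> real \<Rightarrow> real \<Rightarrow> real" where
  "nls_force \<epsilon> \<eta>1 \<eta>2 \<sigma>1 \<sigma>2 c s = \<epsilon> * s - \<eta>1 * s powr (\<sigma>1 + 1) - c * \<eta>2 * s powr (\<sigma>2 + 1)"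

lemma power_primitive:
  assumes "s > 0" "\<sigma> > 0"
  shows "((\<lambda>s. s\<^sup>2 * (2 * \<eta> / (\<sigma> + 2) * s powr \<sigma>)) has_real_derivative 2 * (\<eta> * s powr (\<sigma> + 1))) (at s)"
proof (rule has_field_derivative_transform_within_open[of "\<lambda>s. 2 * \<eta> / (\<sigma> + 2) * s powr (\<sigma> + 2)" _ s "{0<..}"])
  have "((\<lambda>s. 2 * \<eta> / (\<sigma> + 2) * s powr (\<sigma> + 2)) has_real_derivative
      2 * \<eta> / (\<sigma> + 2) * ((\<sigma> + 2) * s powr (\<sigma> + 2 - 1))) (at s)"
    by (intro DERIV_cmult has_real_derivative_powr assms)
  moreover have "2 * \<eta> / (\<sigma> + 2) * ((\<sigma> + 2) * s powr (\<sigma> + 2 - 1)) = 2 * (\<eta> * s powr (\<sigma> + 1))"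
  proof -
    have "\<sigma> + 2 - 1 = \<sigma> + 1" by simp
    then have "s powr (\<sigma> + 2 - 1) = s powr (\<sigma> + 1)" by (rule arg_cong)
    then show ?thesis using assms by (simp del: add_diff_eq)
  qed
  ultimately show "((\<lambda>s. 2 * \<eta> / (\<sigma> + 2) * s powr (\<sigma> + 2)) has_real_derivative 2 * (\<eta> * s powr (\<sigma> + 1))) (at s)"
    by (simp only:)
qed (use assms in \<open>auto simp: powr_add\<close>)

lemma nls_force_primitive:
  assumes "s > 0" "\<sigma>1 > 0" "\<sigma>2 > 0"
  shows "((\<lambda>s. s\<^sup>2 * nls_log_slope_sq \<epsilon> \<eta>1 \<eta>2 \<sigma>1 \<sigma>2 c s) has_real_derivative
    2 * nls_force \<epsilon> \<eta>1 \<eta>2 \<sigma>1 \<sigma>2 c s) (at s)"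
proof -
  have "((\<lambda>s. s\<^sup>2 * \<epsilon> - s\<^sup>2 * (2 * \<eta>1 / (\<sigma>1 + 2) * s powr \<sigma>1) - c * (s\<^sup>2 * (2 * \<eta>2 / (\<sigma>2 + 2) * s powr \<sigma>2)))
      has_real_derivative 2 * s * \<epsilon> - 2 * (\<eta>1 * s powr (\<sigma>1 + 1)) - c * (2 * (\<eta>2 * s powr (\<sigma>2 + 1)))) (at s)"
    using assms by (intro DERIV_diff DERIV_cmult power_primitive) (auto intro!: derivative_eq_intros)
  moreover have "(\<lambda>s. s\<^sup>2 * \<epsilon> - s\<^sup>2 * (2 * \<eta>1 / (\<sigma>1 + 2) * s powr \<sigma>1) - c * (s\<^sup>2 * (2 * \<eta>2 / (\<sigma>2 + 2) * s powr \<sigma>2)))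
      = (\<lambda>s. s\<^sup>2 * nls_log_slope_sq \<epsilon> \<eta>1 \<eta>2 \<sigma>1 \<sigma>2 c s)"
    unfolding nls_log_slope_sq_def right_diff_distrib by (simp only: mult_ac)
  moreover have "2 * s * \<epsilon> - 2 * (\<eta>1 * s powr (\<sigma>1 + 1)) - c * (2 * (\<eta>2 * s powr (\<sigma>2 + 1)))
      = 2 * nls_force \<epsilon> \<eta>1 \<eta>2 \<sigma>1 \<sigma>2 c s"
    by (simp add: nls_force_def algebra_simps)
  ultimately show ?thesis by (simp only:)
qed

text \<open>
  Positivity propagates to smaller arguments, which makes the positive zero unique. In the defocusing case
  put \<open>s = r t\<close> with \<open>r < 1\<close>: passing from \<open>t\<close> to \<open>s\<close> multiplies the focusing term by
  \<open>r powr \<sigma>1\<close>, but \<open>\<epsilon>\<close> by \<open>1\<close> and the defocusing term by \<open>r powr \<sigma>2\<close>, and both factors are at least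
  \<open>r powr \<sigma>1\<close> because \<open>\<sigma>2 < \<sigma>1\<close>.
\<close>

lemma nls_log_slope_sq_pos_below:
  assumes e: "\<epsilon> > 0" and a: "a1 > 0" "a2 > 0" and \<sigma>: "\<sigma>1 > 0" "\<sigma>2 > 0"
    and c: "c = 1 \<or> (c = -1 \<and> \<sigma>2 < \<sigma>1)"
    and st: "0 < s" "s < t" and t: "\<epsilon> - a1 * t powr \<sigma>1 - c * a2 * t powr \<sigma>2 \<ge> 0"
  shows "\<epsilon> - a1 * s powr \<sigma>1 - c * a2 * s powr \<sigma>2 > (0::real)"
  using c
proof
  assume "c = 1"
  have "s powr \<sigma>1 < t powr \<sigma>1" "s powr \<sigma>2 < t powr \<sigma>2"
    using st \<sigma> by (auto intro!: powr_less_mono2)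
  then have "a1 * s powr \<sigma>1 < a1 * t powr \<sigma>1" "a2 * s powr \<sigma>2 < a2 * t powr \<sigma>2" using a by auto
  then show ?thesis using t \<open>c = 1\<close> by simp
next
  assume c: "c = -1 \<and> \<sigma>2 < \<sigma>1"
  define r where "r = s / t"
  have r: "0 < r" "r < 1" and s: "s = r * t" using st by (auto simp: r_def)
  have r1: "r powr \<sigma>1 < 1" using r \<sigma> powr_less_mono2[of \<sigma>1 r 1] by simp
  have r12: "r powr \<sigma>1 \<le> r powr \<sigma>2" using r c by (intro powr_mono') auto
  have "a1 * s powr \<sigma>1 = r powr \<sigma>1 * (a1 * t powr \<sigma>1)" using r st by (simp add: s powr_mult)
  also have "\<dots> \<le> r powr \<sigma>1 * (\<epsilon> + a2 * t powr \<sigma>2)" using t c by (intro mult_left_mono) auto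
  also have "\<dots> = r powr \<sigma>1 * \<epsilon> + r powr \<sigma>1 * (a2 * t powr \<sigma>2)" by (simp add: distrib_left)
  also have "\<dots> < \<epsilon> + r powr \<sigma>2 * (a2 * t powr \<sigma>2)"
    using r1 e r12 a by (intro add_less_le_mono mult_right_mono) auto
  also have "\<dots> = \<epsilon> + a2 * s powr \<sigma>2" using r st by (simp add: s powr_mult)
  finally show ?thesis using c by simp
qed

lemma nls_log_slope_sq_attains_negative:
  assumes e: "\<epsilon> > 0" and a: "a1 > 0" "a2 > 0" and \<sigma>: "\<sigma>1 > 0" "\<sigma>2 > 0"
    and c: "c = 1 \<or> (c = -1 \<and> \<sigma>2 < \<sigma>1)"
  shows "\<exists>s>0. \<epsilon> - a1 * s powr \<sigma>1 - c * a2 * s powr \<sigma>2 < (0::real)"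
  using c
proof
  assume "c = 1"
  define s where "s = (\<epsilon> / a1) powr (1 / \<sigma>1)"
  have "s > 0" using e a by (simp add: s_def)
  moreover have "a1 * s powr \<sigma>1 = \<epsilon>" using e a \<sigma> by (simp add: s_def powr_powr)
  ultimately show ?thesis using \<open>c = 1\<close> a by (intro exI[of _ s]) auto
next
  assume c: "c = -1 \<and> \<sigma>2 < \<sigma>1"
  \<comment> \<open>chosen such that \<open>s \<ge> 1\<close> and \<open>a1 * s powr (\<sigma>1 - \<sigma>2) = a1 + \<epsilon> + a2\<close>\<close>
  define b where "b = 1 + (\<epsilon> + a2) / a1"
  have b: "b \<ge> 1" using e a by (simp add: b_def)
  define s where "s = b powr (1 / (\<sigma>1 - \<sigma>2))"
  have s: "s \<ge> 1" using b c by (simp add: s_def ge_one_powr_ge_zero)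
  have s2: "s powr \<sigma>2 \<ge> 1" using s \<sigma> by (simp add: ge_one_powr_ge_zero)
  have "s powr (\<sigma>1 - \<sigma>2) = b" using b c by (simp add: s_def powr_powr)
  then have "s powr \<sigma>1 = s powr \<sigma>2 * b" by (metis powr_add add.commute diff_add_cancel)
  moreover have "a1 * b = a1 + \<epsilon> + a2" using a by (simp add: b_def field_simps)
  ultimately have "a1 * s powr \<sigma>1 = s powr \<sigma>2 * (a1 + \<epsilon> + a2)" by (metis mult.left_commute)
  also have "\<dots> = s powr \<sigma>2 * (a1 + \<epsilon>) + a2 * s powr \<sigma>2" by (simp add: algebra_simps)
  also have "\<dots> \<ge> 1 * (a1 + \<epsilon>) + a2 * s powr \<sigma>2"
    using s2 a e by (intro add_right_mono mult_right_mono) auto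
  finally show ?thesis using c a s by (intro exI[of _ s]) auto
qed

text \<open>
  At a zero \<open>s0\<close> with terms \<open>P\<close> and \<open>Q\<close> the equation \<open>\<epsilon> = P + c Q\<close> turns \<open>f s0\<close> into
  \<open>- (s0 / 2) (\<sigma>1 P + c \<sigma>2 Q)\<close>, which is negative, for \<open>c = -1\<close> because \<open>Q < P\<close> and \<open>\<sigma>2 < \<sigma>1\<close>.
\<close>

lemma nls_homoclinic_profile:
  assumes e: "\<epsilon> > 0" and \<eta>: "\<eta>1 > 0" "\<eta>2 > 0" and \<sigma>: "\<sigma>1 > 0" "\<sigma>2 > 0"
    and c: "c = 1 \<or> (c = -1 \<and> \<sigma>2 < \<sigma>1)"
  shows "\<exists>s0. homoclinic_profile (nls_log_slope_sq \<epsilon> \<eta>1 \<eta>2 \<sigma>1 \<sigma>2 c) (nls_force \<epsilon> \<eta>1 \<eta>2 \<sigma>1 \<sigma>2 c)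
    (\<lambda>s. \<epsilon> - (\<sigma>1 + 1) * \<eta>1 * s powr \<sigma>1 - c * \<eta>2 * (\<sigma>2 + 1) * s powr \<sigma>2) s0"
proof -
  let ?G = "nls_log_slope_sq \<epsilon> \<eta>1 \<eta>2 \<sigma>1 \<sigma>2 c" and ?f = "nls_force \<epsilon> \<eta>1 \<eta>2 \<sigma>1 \<sigma>2 c"
  define a1 where "a1 = 2 * \<eta>1 / (\<sigma>1 + 2)"
  define a2 where "a2 = 2 * \<eta>2 / (\<sigma>2 + 2)"
  have a: "a1 > 0" "a2 > 0" using \<eta> \<sigma> by (auto simp: a1_def a2_def)
  have G: "?G s = \<epsilon> - a1 * s powr \<sigma>1 - c * a2 * s powr \<sigma>2" for s
    by (simp add: nls_log_slope_sq_def a1_def a2_def)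
  have cont: "continuous_on {0..} ?G"
    unfolding G using \<sigma> by (intro continuous_intros continuous_on_powr') auto
  have G0: "?G 0 = \<epsilon>" by (simp add: G)
  obtain S where S: "S > 0" "?G S < 0"
    using nls_log_slope_sq_attains_negative[OF e a \<sigma> c] by (auto simp: G)
  have "\<exists>s\<ge>0. s \<le> S \<and> ?G s = 0"
    by (rule IVT2') (use S e G0 in \<open>auto intro: continuous_on_subset[OF cont]\<close>)
  then obtain s0 where s0: "s0 \<ge> 0" "?G s0 = 0" by blast
  then have s0': "s0 > 0" using G0 e by (cases "s0 = 0") auto
  have key: "?G s > 0" if "0 < s" "s < t" "?G t \<ge> 0" for s t
    using nls_log_slope_sq_pos_below[OF e a \<sigma> c that(1,2)] that(3) by (simp add: G)
  have "homoclinic_profile ?G ?f (\<lambda>s. \<epsilon> - (\<sigma>1 + 1) * \<eta>1 * s powr \<sigma>1 - c * \<eta>2 * (\<sigma>2 + 1) * s powr \<sigma>2) s0"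
  proof
    show "?G s > 0" if "0 \<le> s" "s < s0" for s
      using key[of s s0] s0 that G0 e by (cases "s = 0") auto
    show "?G s < 0" if "s > s0" for s
      using key[of s0 s] s0 s0' that by (metis less_irrefl not_less)
    show "((\<lambda>s. s\<^sup>2 * ?G s) has_real_derivative 2 * ?f s) (at s)" if "s > 0" for s
      by (rule nls_force_primitive[OF that \<sigma>])
    show "(?f has_real_derivative (\<epsilon> - (\<sigma>1 + 1) * \<eta>1 * s powr \<sigma>1 - c * \<eta>2 * (\<sigma>2 + 1) * s powr \<sigma>2)) (at s)"
      if "s > 0" for s
    proof -
      have p: "((\<lambda>s. s powr (\<sigma> + 1)) has_real_derivative (\<sigma> + 1) * s powr \<sigma>) (at s)" for \<sigma>
        using has_real_derivative_powr[OF that, of "\<sigma> + 1"] by simp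
      show ?thesis unfolding nls_force_def[abs_def] using that
        by (auto intro!: derivative_eq_intros p)
    qed
    show "continuous_on {0<..} (\<lambda>s. \<epsilon> - (\<sigma>1 + 1) * \<eta>1 * s powr \<sigma>1 - c * \<eta>2 * (\<sigma>2 + 1) * s powr \<sigma>2)"
      by (intro continuous_intros) auto
    show "?f s0 < 0"
    proof -
      define P where "P = a1 * s0 powr \<sigma>1"
      define Q where "Q = a2 * s0 powr \<sigma>2"
      have PQ: "P > 0" "Q > 0" using a s0' by (auto simp: P_def Q_def)
      have z: "\<epsilon> = P + c * Q" using s0(2) by (simp add: G P_def Q_def)
      have p1: "\<eta>1 * s0 powr (\<sigma>1 + 1) = s0 * ((\<sigma>1 / 2 + 1) * P)"
        using \<sigma> s0' by (simp add: powr_add P_def a1_def field_simps)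
      have p2: "\<eta>2 * s0 powr (\<sigma>2 + 1) = s0 * ((\<sigma>2 / 2 + 1) * Q)"
        using \<sigma> s0' by (simp add: powr_add Q_def a2_def field_simps)
      have "?f s0 = \<epsilon> * s0 - s0 * ((\<sigma>1 / 2 + 1) * P) - c * (s0 * ((\<sigma>2 / 2 + 1) * Q))"
        unfolding nls_force_def by (simp only: p1 p2 mult.assoc)
      also have "\<dots> = - (s0 / 2) * (\<sigma>1 * P + c * (\<sigma>2 * Q))"
        unfolding z by (simp add: field_simps)
      also have "\<dots> < 0"
      proof -
        have "\<sigma>1 * P + c * (\<sigma>2 * Q) > 0"
          using c
        proof
          assume "c = 1" then show ?thesis using PQ \<sigma> by (simp add: add_pos_pos)
        next
          assume c: "c = -1 \<and> \<sigma>2 < \<sigma>1"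
          then have "Q < P" using z e by simp
          then have "\<sigma>2 * Q < \<sigma>1 * P" using c PQ \<sigma> by (intro mult_strict_mono) auto
          then show ?thesis using c by simp
        qed
        then show ?thesis using s0' by (simp add: mult_neg_pos)
      qed
      finally show ?thesis .
    qed
  qed (use s0 s0' cont in auto)
  then show ?thesis by blast
qed

proposition nls_bound_state_exists:
  assumes e: "\<epsilon> > 0" and \<eta>: "\<eta>1 > 0" "\<eta>2 > 0" and \<sigma>: "\<sigma>1 > 0" "\<sigma>2 > 0"
    and c: "c = 1 \<or> (c = -1 \<and> \<sigma>2 < \<sigma>1)"
  obtains \<psi> \<psi>' C \<kappa> where "nls_bound_state \<epsilon> \<eta>1 \<eta>2 \<sigma>1 \<sigma>2 c \<psi>"
    "\<And>x. (\<psi> has_real_derivative \<psi>' x) (at x)"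
    "\<And>x. (\<psi>' has_real_derivative nls_force \<epsilon> \<eta>1 \<eta>2 \<sigma>1 \<sigma>2 c (\<psi> x)) (at x)"
    "\<And>x. (\<psi>' x)\<^sup>2 = (\<psi> x)\<^sup>2 * nls_log_slope_sq \<epsilon> \<eta>1 \<eta>2 \<sigma>1 \<sigma>2 c (\<psi> x)"
    "\<kappa> > 0" "\<And>x. \<psi> x \<le> C * exp (- \<kappa> * \<bar>x\<bar>)" "\<And>x. \<bar>\<psi>' x\<bar> \<le> C * exp (- \<kappa> * \<bar>x\<bar>)"
proof -
  let ?f = "nls_force \<epsilon> \<eta>1 \<eta>2 \<sigma>1 \<sigma>2 c"
  obtain s0 where "homoclinic_profile (nls_log_slope_sq \<epsilon> \<eta>1 \<eta>2 \<sigma>1 \<sigma>2 c) ?f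
    (\<lambda>s. \<epsilon> - (\<sigma>1 + 1) * \<eta>1 * s powr \<sigma>1 - c * \<eta>2 * (\<sigma>2 + 1) * s powr \<sigma>2) s0"
    using nls_homoclinic_profile[OF assms] by blast
  then interpret homoclinic_profile "nls_log_slope_sq \<epsilon> \<eta>1 \<eta>2 \<sigma>1 \<sigma>2 c" ?f
    "\<lambda>s. \<epsilon> - (\<sigma>1 + 1) * \<eta>1 * s powr \<sigma>1 - c * \<eta>2 * (\<sigma>2 + 1) * s powr \<sigma>2" s0 .
  obtain u v C \<kappa> where sol: "solution u v" and init: "u 0 = s0" "v 0 = 0"
    and energy: "\<And>x. (v x)\<^sup>2 = (u x)\<^sup>2 * nls_log_slope_sq \<epsilon> \<eta>1 \<eta>2 \<sigma>1 \<sigma>2 c (u x)"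
    and \<kappa>: "\<kappa> > 0" and bound: "\<And>x. u x \<le> C * exp (- \<kappa> * \<bar>x\<bar>)" "\<And>x. \<bar>v x\<bar> \<le> C * exp (- \<kappa> * \<bar>x\<bar>)"
    using homoclinic_solution by metis
  have pos: "u x > 0" and u: "(u has_real_derivative v x) (at x)" and v: "(v has_real_derivative ?f (u x)) (at x)" for x
    using sol by (auto simp: solution_def)
  have "sobolev_H1 u"
  proof (rule sobolev_H1_of_exp_decay)
    show "(u has_vector_derivative v x) (at x)" for x
      using u by (simp add: has_real_derivative_iff_has_vector_derivative)
    show "continuous_on UNIV v" by (meson v DERIV_isCont continuous_at_imp_continuous_on)
    show "norm (u x) \<le> C * exp (- \<kappa> * \<bar>x\<bar>)" for x using bound(1)[of x] pos[of x] by simp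
    show "norm (v x) \<le> C * exp (- \<kappa> * \<bar>x\<bar>)" for x using bound(2)[of x] by simp
  qed (rule \<kappa>)
  then have "nls_positive_solution \<epsilon> \<eta>1 \<eta>2 \<sigma>1 \<sigma>2 c u"
    unfolding nls_positive_solution_def nls_force_def[symmetric] using pos u v
    by (intro conjI exI[of _ v] exI[of _ "\<lambda>x. ?f (u x)"] allI) auto
  moreover have "\<exists>a. \<forall>x. w x = u (x + a)" if w: "nls_positive_solution \<epsilon> \<eta>1 \<eta>2 \<sigma>1 \<sigma>2 c w" for w
  proof -
    obtain w' w'' where w': "\<And>x. (w has_real_derivative w' x) (at x) \<and> (w' has_real_derivative w'' x) (at x) \<and>
        w'' x = \<epsilon> * w x - \<eta>1 * w x powr (\<sigma>1 + 1) - c * \<eta>2 * w x powr (\<sigma>2 + 1)"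
      using w unfolding nls_positive_solution_def by auto
    have "solution w w'"
      unfolding solution_def
    proof (intro allI conjI)
      fix x
      show "w x > 0" using w by (simp add: nls_positive_solution_def)
      show "(w has_real_derivative w' x) (at x)" using w' by blast
      show "(w' has_real_derivative ?f (w x)) (at x)"
        using w'[of x] unfolding nls_force_def by metis
    qed
    moreover have "integrable lborel (\<lambda>x. (w x)\<^sup>2)"
      using w by (simp add: nls_positive_solution_def sobolev_H1_def square_integrable_def)
    ultimately show ?thesis using square_integrable_solution_unique[OF sol init] by blast
  qed
  ultimately have "nls_bound_state \<epsilon> \<eta>1 \<eta>2 \<sigma>1 \<sigma>2 c u" by (simp add: nls_bound_state_def)
  then show ?thesis using that u v energy \<kappa> bound by blast
qed


section \<open>The parameters in complex form\<close>

text \<open>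
  The coefficient that a power \<open>\<psi> powr (\<sigma> + 1)\<close> in \<open>- \<psi>''\<close> acquires in \<open>- \<phi>''\<close>, after division by the
  phase \<open>exp(i d ln \<psi>)\<close>: the summand \<open>1\<close> of the second factor comes from \<open>\<psi>''\<close>, the other one
  from \<open>\<psi>'\<^sup>2 / \<psi>\<close>.
\<close>

definition profile_factor :: "real \<Rightarrow> real \<Rightarrow> complex" where
  "profile_factor d \<sigma> = (1 + \<i> * of_real d) * (1 + 2 * \<i> * of_real d / of_real (\<sigma> + 2))"

lemma profile_factor_Re: "\<sigma> > 0 \<Longrightarrow> Re (profile_factor d \<sigma>) = (\<sigma> + 2 - 2 * d\<^sup>2) / (\<sigma> + 2)"
  by (simp add: profile_factor_def Re_divide_of_real Im_divide_of_real field_simps power2_eq_square)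

lemma profile_factor_Im: "\<sigma> > 0 \<Longrightarrow> Im (profile_factor d \<sigma>) = d * (\<sigma> + 4) / (\<sigma> + 2)"
  by (simp add: profile_factor_def Re_divide_of_real Im_divide_of_real field_simps power2_eq_square)

text \<open>
  The reason for the normalisation \<open>1 + d\<^sup>2\<close> in \<open>\<eta>\<close>: if \<open>(cos, sin)\<close> of \<open>\<gamma> - \<theta>\<close> is a multiple of the
  profile factor, then \<open>\<eta>\<close> is the proportionality constant.
\<close>

lemma profile_factor_projection:
  assumes "\<sigma> > 0"
  shows "d * Im (profile_factor d \<sigma>) + Re (profile_factor d \<sigma>) = 1 + d\<^sup>2"
proof -
  have "d * Im (profile_factor d \<sigma>) + Re (profile_factor d \<sigma>) =
      (d * (d * (\<sigma> + 4)) + (\<sigma> + 2 - 2 * d\<^sup>2)) / (\<sigma> + 2)"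
    unfolding profile_factor_Re[OF assms] profile_factor_Im[OF assms] by (simp add: add_divide_distrib)
  also have "d * (d * (\<sigma> + 4)) + (\<sigma> + 2 - 2 * d\<^sup>2) = (1 + d\<^sup>2) * (\<sigma> + 2)"
    by (simp add: algebra_simps power2_eq_square)
  finally show ?thesis using assms by simp
qed

lemma one_plus_sq_pos: "1 + d\<^sup>2 > (0::real)"
  by (simp add: add_pos_nonneg)

text \<open>
  The tangent equation, its infinite case included, says that \<open>(cos (\<gamma> - \<theta>), sin (\<gamma> - \<theta>))\<close> is parallel to the
  profile factor. The sign condition selects the positive one of the two directions.
\<close>

lemma is_gamma_imp_cis:
  assumes g: "is_gamma \<theta> d \<sigma> \<gamma>" and "d \<noteq> 0" and \<sigma>: "\<sigma> > 0"
  shows "cis \<gamma> = cis \<theta> * (of_real (eta_param \<theta> d \<gamma>) * profile_factor d \<sigma>)"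
    and "eta_param \<theta> d \<gamma> > 0"
proof -
  let ?x = "cos (\<gamma> - \<theta>)" and ?y = "sin (\<gamma> - \<theta>)" and ?\<eta> = "eta_param \<theta> d \<gamma>"
  define A where "A = Re (profile_factor d \<sigma>)"
  define B where "B = Im (profile_factor d \<sigma>)"
  have AB: "d * B + A = 1 + d\<^sup>2" using profile_factor_projection[OF \<sigma>] by (simp add: A_def B_def)
  have par: "?x * B = ?y * A"
  proof (cases "\<sigma> + 2 - 2 * d\<^sup>2 = 0")
    case True
    then have "A = 0" "?x = 0" using g \<sigma> by (auto simp: A_def profile_factor_Re is_gamma_def)
    then show ?thesis by simp
  next
    case False
    have t: "tan (\<gamma> - \<theta>) = B / A"
      using g False \<sigma> by (simp add: is_gamma_def A_def B_def profile_factor_Re profile_factor_Im)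
    have "A \<noteq> 0" "B \<noteq> 0" using False \<sigma> \<open>d \<noteq> 0\<close> by (auto simp: A_def B_def profile_factor_Re profile_factor_Im)
    then have "?x \<noteq> 0" using t by (auto simp: tan_def)
    have "?y / ?x = B / A" using t unfolding tan_def .
    then have "?y * A = B * ?x" by (rule iffD1[OF frac_eq_eq[OF \<open>?x \<noteq> 0\<close> \<open>A \<noteq> 0\<close>]])
    then show ?thesis by (simp add: mult.commute)
  qed
  have pos: "1 + d\<^sup>2 > 0" by (rule one_plus_sq_pos)
  have eta: "?\<eta> * (1 + d\<^sup>2) = d * ?y + ?x" using pos by (simp add: eta_param_def)
  show "?\<eta> > 0" using g pos by (simp add: eta_param_def is_gamma_def)
  have "?x * (1 + d\<^sup>2) = ?\<eta> * A * (1 + d\<^sup>2)"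
  proof -
    have "?x * (1 + d\<^sup>2) = d * (?x * B) + ?x * A" by (simp add: AB[symmetric] algebra_simps)
    also have "\<dots> = (d * ?y + ?x) * A" unfolding par by (simp add: algebra_simps)
    finally show ?thesis by (simp add: eta[symmetric])
  qed
  then have x: "?x = ?\<eta> * A" using pos by simp
  have "?y * (1 + d\<^sup>2) = ?\<eta> * B * (1 + d\<^sup>2)"
  proof -
    have "?y * (1 + d\<^sup>2) = d * ?y * B + ?y * A" by (simp add: AB[symmetric] algebra_simps)
    also have "\<dots> = (d * ?y + ?x) * B" unfolding par[symmetric] by (simp add: algebra_simps)
    finally show ?thesis by (simp add: eta[symmetric])
  qed
  then have y: "?y = ?\<eta> * B" using pos by simp
  have "cis (\<gamma> - \<theta>) = of_real ?\<eta> * profile_factor d \<sigma>"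
    by (rule complex_eqI) (simp_all add: x y A_def B_def)
  then show "cis \<gamma> = cis \<theta> * (of_real ?\<eta> * profile_factor d \<sigma>)"
    by (metis cis_mult add.commute diff_add_cancel)
qed

lemma is_gamma_of_cis:
  assumes "cis \<gamma> = cis \<theta> * (of_real l * profile_factor d \<sigma>)" and "l > 0" and \<sigma>: "\<sigma> > 0"
    and "- pi < \<gamma>" "\<gamma> \<le> pi"
  shows "is_gamma \<theta> d \<sigma> \<gamma>"
proof -
  have "cis (\<gamma> - \<theta>) = of_real l * profile_factor d \<sigma>"
    using assms(1) by (simp add: cis_divide[symmetric])
  from arg_cong[OF this, of Re] arg_cong[OF this, of Im]
  have xy: "cos (\<gamma> - \<theta>) = l * Re (profile_factor d \<sigma>)" "sin (\<gamma> - \<theta>) = l * Im (profile_factor d \<sigma>)" by simp_all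
  have "d * sin (\<gamma> - \<theta>) + cos (\<gamma> - \<theta>) = l * (1 + d\<^sup>2)"
    unfolding profile_factor_projection[OF \<sigma>, symmetric] xy by (simp add: algebra_simps)
  then have "d * sin (\<gamma> - \<theta>) + cos (\<gamma> - \<theta>) > 0" using \<open>l > 0\<close> one_plus_sq_pos by simp
  moreover have "cos (\<gamma> - \<theta>) = 0" if "\<sigma> + 2 - 2 * d\<^sup>2 = 0"
    using that \<sigma> by (simp add: xy profile_factor_Re)
  moreover have "tan (\<gamma> - \<theta>) = d * (\<sigma> + 4) / (\<sigma> + 2 - 2 * d\<^sup>2)" 
    using \<sigma> \<open>l > 0\<close> by (simp add: tan_def xy profile_factor_Re profile_factor_Im)
  ultimately show ?thesis using assms(4,5) by (simp add: is_gamma_def)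
qed

text \<open>
  Up to a positive factor \<open>cis \<gamma>\<close> is prescribed, so \<open>\<gamma>\<close> is the principal argument.
\<close>

lemma is_gamma_ex1:
  assumes "d \<noteq> 0" and \<sigma>: "\<sigma> > 0"
  shows "\<exists>!\<gamma>. is_gamma \<theta> d \<sigma> \<gamma>"
proof -
  define w where "w = cis \<theta> * profile_factor d \<sigma>"
  have "Im (profile_factor d \<sigma>) \<noteq> 0" using assms by (simp add: profile_factor_Im)
  then have pf: "profile_factor d \<sigma> \<noteq> 0" by auto
  then have w: "w \<noteq> 0" by (simp add: w_def)
  have "cis (Arg w) = cis \<theta> * (of_real (1 / norm w) * profile_factor d \<sigma>)"
    using w by (simp add: cis_Arg sgn_eq w_def)
  then have ex: "is_gamma \<theta> d \<sigma> (Arg w)"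
    by (rule is_gamma_of_cis) (use w \<sigma> Arg_bounded[of w] in auto)
  have "\<gamma> = Arg w" if g: "is_gamma \<theta> d \<sigma> \<gamma>" for \<gamma>
  proof -
    have "cis \<gamma> = of_real (eta_param \<theta> d \<gamma>) * w"
      using is_gamma_imp_cis(1)[OF g assms] by (simp add: w_def mult_ac)
    moreover have "sgn (of_real (eta_param \<theta> d \<gamma>) * w) = sgn w"
      using is_gamma_imp_cis(2)[OF g assms] by (simp add: sgn_mult sgn_of_real)
    ultimately have "sgn w = cis \<gamma>" by (metis sgn_cis)
    then show ?thesis using g cis_Arg_unique[of w \<gamma>] by (simp add: is_gamma_def)
  qed
  with ex show ?thesis by blast
qed

text \<open>
  In polar form: write \<open>(i \<omega> - k) exp(- i \<theta>) = - X + i Y\<close>. The last claim is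
  \<open>\<epsilon> (1 + i d)\<^sup>2 = - X + i Y\<close>. So \<open>d\<close> is the tangent of half the argument of \<open>- X + i Y\<close>, and
  \<open>\<epsilon> (1 + d\<^sup>2)\<close> is its modulus \<open>r\<close>.
\<close>

lemma d_eps_identity:
  fixes \<theta> \<omega> k :: real
  assumes nz: "\<omega> * cos \<theta> + k * sin \<theta> \<noteq> 0"
  defines "d \<equiv> d_param \<theta> \<omega> k"
  defines "\<epsilon> \<equiv> eps_param d \<omega> k"
  shows "d \<noteq> 0" "\<epsilon> > 0"
    and "cis \<theta> * ((1 + \<i> * of_real d)\<^sup>2 * of_real \<epsilon>) = \<i> * of_real \<omega> - of_real k"
proof -
  define X where "X = k * cos \<theta> - \<omega> * sin \<theta>"
  define Y where "Y = \<omega> * cos \<theta> + k * sin \<theta>"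
  define r where "r = sqrt (\<omega>\<^sup>2 + k\<^sup>2)"
  have cs: "cos \<theta> * cos \<theta> + sin \<theta> * sin \<theta> = 1" using sin_cos_squared_add3 by blast
  have XY: "X * cos \<theta> + Y * sin \<theta> = k" "Y * cos \<theta> - X * sin \<theta> = \<omega>"
    using cs unfolding X_def Y_def by algebra+
  have "X\<^sup>2 + Y\<^sup>2 = \<omega>\<^sup>2 + k\<^sup>2" using cs unfolding X_def Y_def by algebra
  then have r2: "r\<^sup>2 = X\<^sup>2 + Y\<^sup>2" by (simp add: r_def)
  have Y: "Y \<noteq> 0" using nz by (simp add: Y_def)
  have r0: "r \<ge> 0" by (simp add: r_def)
  have "X\<^sup>2 < r\<^sup>2" using r2 Y by simp
  then have "\<bar>X\<bar> < r" using r0 power2_less_imp_less[of "\<bar>X\<bar>" r] by simp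
  then have Xr: "X + r > 0" "r > 0" by auto
  have d: "d = (X + r) / Y" by (simp add: d_def d_param_def X_def Y_def r_def)
  show d0: "d \<noteq> 0" using Xr Y by (simp add: d)
  have dd: "1 + d\<^sup>2 = 2 * r * (X + r) / Y\<^sup>2"
    using Y r2 by (simp add: d power2_eq_square field_simps)
  have e: "\<epsilon> = r / (1 + d\<^sup>2)" by (simp add: \<epsilon>_def eps_param_def r_def)
  show "\<epsilon> > 0" using Xr one_plus_sq_pos by (simp add: e)
  have e': "\<epsilon> = Y\<^sup>2 / (2 * (X + r))" unfolding e dd using Xr Y by simp
  have im: "2 * d * \<epsilon> = Y"
  proof -
    have cancel: "2 * (q / Y) * (Y\<^sup>2 / (2 * q)) = Y" if "q \<noteq> 0" for q
      using that Y by (simp add: power2_eq_square)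
    show ?thesis unfolding d e' by (rule cancel) (use Xr in simp)
  qed
  have re: "\<epsilon> - d\<^sup>2 * \<epsilon> = - X"
  proof -
    have "\<epsilon> * (1 + d\<^sup>2) = r" unfolding e using one_plus_sq_pos[of d] by simp
    then have "\<epsilon> + d\<^sup>2 * \<epsilon> = r" by (simp add: algebra_simps)
    moreover have "2 * \<epsilon> = r - X"
    proof -
      have "Y\<^sup>2 = (r - X) * (X + r)" using r2 by (simp add: algebra_simps power2_eq_square)
      then have "\<epsilon> = (r - X) * (X + r) / (2 * (X + r))" by (simp only: e')
      moreover have "2 * (a * q / (2 * q)) = a" if "q \<noteq> 0" for a q :: real
        using that by simp
      ultimately show ?thesis using Xr(1) by (metis less_irrefl)
    qed
    ultimately show ?thesis by simp
  qed
  have sq: "(1 + \<i> * of_real d)\<^sup>2 * of_real \<epsilon> = Complex (- X) Y"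
    using im re by (intro complex_eqI) (simp_all add: power2_eq_square algebra_simps)
  show "cis \<theta> * ((1 + \<i> * of_real d)\<^sup>2 * of_real \<epsilon>) = \<i> * of_real \<omega> - of_real k"
    unfolding sq using XY by (intro complex_eqI) (simp_all add: algebra_simps)
qed

text \<open>
  Each derivative of the phase \<open>e\<close> produces the factor \<open>i d \<psi>' / \<psi>\<close>.
\<close>

lemma phase_profile_derivatives:
  fixes \<psi> \<psi>' :: "real \<Rightarrow> real" and d :: real
  assumes pos: "\<And>x. \<psi> x > 0"
    and d1: "\<And>x. (\<psi> has_real_derivative \<psi>' x) (at x)"
    and d2: "\<And>x. (\<psi>' has_real_derivative \<psi>'' x) (at x)"
  defines "e \<equiv> \<lambda>x. exp (\<i> * of_real d * of_real (ln (\<psi> x)))"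
  shows "((\<lambda>x. of_real (\<psi> x) * e x) has_vector_derivative (1 + \<i> * of_real d) * of_real (\<psi>' x) * e x) (at x)"
    and "((\<lambda>x. (1 + \<i> * of_real d) * of_real (\<psi>' x) * e x) has_vector_derivative
      (1 + \<i> * of_real d) * (of_real (\<psi>'' x) + \<i> * of_real (d * (\<psi>' x)\<^sup>2 / \<psi> x)) * e x) (at x)"
proof -
  have R: "((\<lambda>x. of_real (g x) :: complex) has_vector_derivative of_real D) (at x)"
    if "(g has_real_derivative D) (at x)" for g D x
    using that by (simp add: has_vector_derivative_of_real has_real_derivative_iff_has_vector_derivative)
  have ln: "((\<lambda>x. ln (\<psi> x)) has_real_derivative \<psi>' x / \<psi> x) (at x)" for x
    using DERIV_chain2[OF DERIV_ln_divide[OF pos] d1] by simp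
  have "((\<lambda>x. \<i> * of_real d * of_real (ln (\<psi> x))) has_vector_derivative \<i> * of_real d * of_real (\<psi>' x / \<psi> x)) (at x)" for x
    by (rule has_vector_derivative_mult_right[OF R[OF ln]])
  then have E: "(e has_vector_derivative (\<i> * of_real d * of_real (\<psi>' x / \<psi> x)) * e x) (at x)" for x
    unfolding e_def using field_vector_diff_chain_at[OF _ DERIV_exp] by (fastforce simp: o_def)
  show "((\<lambda>x. of_real (\<psi> x) * e x) has_vector_derivative (1 + \<i> * of_real d) * of_real (\<psi>' x) * e x) (at x)"
    using has_vector_derivative_mult[OF R[OF d1] E, of x] pos[of x]
    by (simp add: algebra_simps)
  show "((\<lambda>x. (1 + \<i> * of_real d) * of_real (\<psi>' x) * e x) has_vector_derivative
      (1 + \<i> * of_real d) * (of_real (\<psi>'' x) + \<i> * of_real (d * (\<psi>' x)\<^sup>2 / \<psi> x)) * e x) (at x)"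
  proof -
    have "((\<lambda>x. (1 + \<i> * of_real d) * of_real (\<psi>' x)) has_vector_derivative
        (1 + \<i> * of_real d) * of_real (\<psi>'' x)) (at x)"
      by (rule has_vector_derivative_mult_right[OF R[OF d2]])
    from has_vector_derivative_mult[OF this E] show ?thesis
      by (simp add: algebra_simps power2_eq_square)
  qed
qed

section \<open>Bound-states of the Ginzburg-Landau equation\<close>

text \<open>
  The two signs of the second nonlinearity are treated at once. The three coefficients of the Ginzburg-Landau equation, those of \<open>\<phi>\<close>
  and of its two nonlinear terms, are matched separately.
\<close>

proposition admits_phase_bound_state_of_exponents:
  assumes \<sigma>: "\<sigma>1 > 0" "\<sigma>2 > 0" and nz: "\<omega> * cos \<theta> + k * sin \<theta> \<noteq> 0"
    and c: "c = 1 \<or> (c = -1 \<and> \<sigma>2 < \<sigma>1)"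
  shows "admits_phase_bound_state \<theta> \<omega> k \<sigma>1 \<sigma>2 c"
proof -
  define d where "d = d_param \<theta> \<omega> k"
  define \<epsilon> where "\<epsilon> = eps_param d \<omega> k"
  define \<gamma>1 where "\<gamma>1 = gamma_param \<theta> d \<sigma>1"
  define \<gamma>2 where "\<gamma>2 = gamma_param \<theta> d \<sigma>2"
  define \<eta>1 where "\<eta>1 = eta_param \<theta> d \<gamma>1"
  define \<eta>2 where "\<eta>2 = eta_param \<theta> d \<gamma>2"
  have d: "d \<noteq> 0" and \<epsilon>: "\<epsilon> > 0"
    and lin: "cis \<theta> * ((1 + \<i> * of_real d)\<^sup>2 * of_real \<epsilon>) = \<i> * of_real \<omega> - of_real k"
    unfolding d_def \<epsilon>_def using d_eps_identity[OF nz] by auto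
  have \<gamma>: "is_gamma \<theta> d \<sigma>1 \<gamma>1" "is_gamma \<theta> d \<sigma>2 \<gamma>2"
    unfolding \<gamma>1_def \<gamma>2_def gamma_param_def using theI'[OF is_gamma_ex1[OF d]] \<sigma> by auto
  note nl1 = is_gamma_imp_cis[OF \<gamma>(1) d \<sigma>(1), folded \<eta>1_def]
  note nl2 = is_gamma_imp_cis[OF \<gamma>(2) d \<sigma>(2), folded \<eta>2_def]
  obtain \<psi> \<psi>' C \<kappa> where bs: "nls_bound_state \<epsilon> \<eta>1 \<eta>2 \<sigma>1 \<sigma>2 c \<psi>"
    and d1: "\<And>x. (\<psi> has_real_derivative \<psi>' x) (at x)"
    and d2: "\<And>x. (\<psi>' has_real_derivative nls_force \<epsilon> \<eta>1 \<eta>2 \<sigma>1 \<sigma>2 c (\<psi> x)) (at x)"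
    and energy: "\<And>x. (\<psi>' x)\<^sup>2 = (\<psi> x)\<^sup>2 * nls_log_slope_sq \<epsilon> \<eta>1 \<eta>2 \<sigma>1 \<sigma>2 c (\<psi> x)"
    and \<kappa>: "\<kappa> > 0" and bound: "\<And>x. \<psi> x \<le> C * exp (- \<kappa> * \<bar>x\<bar>)" "\<And>x. \<bar>\<psi>' x\<bar> \<le> C * exp (- \<kappa> * \<bar>x\<bar>)"
    using nls_bound_state_exists[OF \<epsilon> nl1(2) nl2(2) \<sigma> c] by metis
  have pos: "\<psi> x > 0" for x using bs by (simp add: nls_bound_state_def nls_positive_solution_def)
  define e where "e x = exp (\<i> * of_real d * of_real (ln (\<psi> x)))" for x
  define \<phi> where "\<phi> x = of_real (\<psi> x) * e x" for x
  define \<phi>' where "\<phi>' x = (1 + \<i> * of_real d) * of_real (\<psi>' x) * e x" for x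
  define \<phi>'' where "\<phi>'' x = (1 + \<i> * of_real d) *
    (of_real (nls_force \<epsilon> \<eta>1 \<eta>2 \<sigma>1 \<sigma>2 c (\<psi> x)) + \<i> * of_real (d * (\<psi>' x)\<^sup>2 / \<psi> x)) * e x" for x
  have D1: "(\<phi> has_vector_derivative \<phi>' x) (at x)" and D2: "(\<phi>' has_vector_derivative \<phi>'' x) (at x)" for x
    unfolding \<phi>_def[abs_def] \<phi>'_def[abs_def] \<phi>''_def e_def
    by (rule phase_profile_derivatives[OF pos d1 d2])+
  have ne: "norm (e x) = 1" for x unfolding e_def by simp
  have n\<phi>: "norm (\<phi> x) = \<psi> x" for x using pos[of x] by (simp add: \<phi>_def norm_mult ne)
  have H1: "sobolev_H1 \<phi>"
  proof (rule sobolev_H1_of_exp_decay[OF D1 _ \<kappa>])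
    show "continuous_on UNIV \<phi>'"
      using D2 by (meson has_vector_derivative_continuous continuous_at_imp_continuous_on)
    show "norm (\<phi> x) \<le> C * exp (- \<kappa> * \<bar>x\<bar>)" for x using bound(1) by (simp add: n\<phi>)
    show "norm (\<phi>' x) \<le> (norm (1 + \<i> * of_real d) * C) * exp (- \<kappa> * \<bar>x\<bar>)" for x
      using mult_left_mono[OF bound(2)[of x], of "norm (1 + \<i> * of_real d)"]
      by (simp add: \<phi>'_def norm_mult ne mult.assoc)
  qed
  have eqn: "\<i> * of_real \<omega> * \<phi> x = exp (\<i> * of_real \<theta>) * \<phi>'' x
      + exp (\<i> * of_real \<gamma>1) * of_real (norm (\<phi> x) powr \<sigma>1) * \<phi> x
      + of_real c * exp (\<i> * of_real \<gamma>2) * of_real (norm (\<phi> x) powr \<sigma>2) * \<phi> x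
      + of_real k * \<phi> x" for x
  proof -
    define P where "P = \<psi> x powr \<sigma>1"
    define Q where "Q = \<psi> x powr \<sigma>2"
    define w :: complex where "w = 1 + \<i> * of_real d"
    have f: "nls_force \<epsilon> \<eta>1 \<eta>2 \<sigma>1 \<sigma>2 c (\<psi> x) = (\<epsilon> - \<eta>1 * P - c * \<eta>2 * Q) * \<psi> x"
      using pos[of x] by (simp add: nls_force_def P_def Q_def powr_add algebra_simps)
    have g: "d * (\<psi>' x)\<^sup>2 / \<psi> x = d * (\<epsilon> - 2 * \<eta>1 / (\<sigma>1 + 2) * P - c * (2 * \<eta>2 / (\<sigma>2 + 2)) * Q) * \<psi> x"
    proof -
      have "d * (\<psi>' x)\<^sup>2 / \<psi> x = d * nls_log_slope_sq \<epsilon> \<eta>1 \<eta>2 \<sigma>1 \<sigma>2 c (\<psi> x) * \<psi> x"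
        unfolding energy using pos[of x] by (simp add: power2_eq_square)
      then show ?thesis by (simp only: nls_log_slope_sq_def P_def Q_def)
    qed
    have expand: "of_real ((\<epsilon> - \<eta>1 * P - c * \<eta>2 * Q) * \<psi> x)
        + \<i> * of_real (d * (\<epsilon> - 2 * \<eta>1 / (\<sigma>1 + 2) * P - c * (2 * \<eta>2 / (\<sigma>2 + 2)) * Q) * \<psi> x)
      = (w * of_real \<epsilon> - of_real (\<eta>1 * P) * (1 + 2 * \<i> * of_real d / of_real (\<sigma>1 + 2))
         - of_real (c * \<eta>2 * Q) * (1 + 2 * \<i> * of_real d / of_real (\<sigma>2 + 2))) * of_real (\<psi> x)"
      unfolding w_def by (simp add: algebra_simps)
    have "exp (\<i> * of_real \<theta>) * \<phi>'' x = cis \<theta> * (w * ((w * of_real \<epsilon>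
         - of_real (\<eta>1 * P) * (1 + 2 * \<i> * of_real d / of_real (\<sigma>1 + 2))
         - of_real (c * \<eta>2 * Q) * (1 + 2 * \<i> * of_real d / of_real (\<sigma>2 + 2))) * of_real (\<psi> x)) * e x)"
      unfolding \<phi>''_def f g expand w_def[symmetric] cis_conv_exp ..
    also have "\<dots> = (cis \<theta> * (w\<^sup>2 * of_real \<epsilon>)
         - cis \<theta> * (of_real \<eta>1 * profile_factor d \<sigma>1) * of_real P
         - of_real c * (cis \<theta> * (of_real \<eta>2 * profile_factor d \<sigma>2)) * of_real Q) * \<phi> x"
      unfolding profile_factor_def w_def[symmetric] \<phi>_def of_real_mult power2_eq_square
      by (simp add: ring_distribs mult_ac)
    also have "\<dots> = (\<i> * of_real \<omega> - of_real k - cis \<gamma>1 * of_real P - of_real c * cis \<gamma>2 * of_real Q) * \<phi> x"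
      unfolding nl1(1)[symmetric] nl2(1)[symmetric] w_def lin ..
    finally have "exp (\<i> * of_real \<theta>) * \<phi>'' x = \<dots>" .
    then show ?thesis unfolding n\<phi> P_def[symmetric] Q_def[symmetric] cis_conv_exp[symmetric]
      by (simp add: algebra_simps)
  qed
  have "\<phi> 0 \<noteq> 0" using n\<phi>[of 0] pos[of 0] by auto
  then have "cgl_bound_state \<theta> \<gamma>1 \<gamma>2 \<sigma>1 \<sigma>2 c \<omega> k \<phi>"
    unfolding cgl_bound_state_def using H1 D1 D2 eqn by blast
  then have "cgl_bound_state \<theta> \<gamma>1 \<gamma>2 \<sigma>1 \<sigma>2 c \<omega> k
      (\<lambda>x. of_real (\<psi> x) * exp (\<i> * of_real d * of_real (ln (\<psi> x))))"
    by (simp add: \<phi>_def[abs_def] e_def)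
  then show ?thesis
    unfolding admits_phase_bound_state_def Let_def
    using bs unfolding d_def \<epsilon>_def \<gamma>1_def \<gamma>2_def \<eta>1_def \<eta>2_def by blast
qed

theorem theorem1p3:
  fixes \<sigma>1 \<theta> \<omega> k :: real
  assumes "\<sigma>1 > 0"
    and "- pi / 2 < \<theta>" and "\<theta> < pi / 2"
    and "\<omega> * cos \<theta> + k * sin \<theta> \<noteq> 0"
  shows "(\<forall>\<sigma>>0. \<exists>!\<gamma>. is_gamma \<theta> (d_param \<theta> \<omega> k) \<sigma> \<gamma>) \<and>
    (\<forall>\<sigma>2>0. admits_phase_bound_state \<theta> \<omega> k \<sigma>1 \<sigma>2 1) \<and>
    (\<exists>\<delta>>0. \<forall>\<sigma>2. 0 < \<sigma>2 \<and> \<sigma>2 < \<delta> \<longrightarrow> admits_phase_bound_state \<theta> \<omega> k \<sigma>1 \<sigma>2 (-1))"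
proof (intro conjI allI impI)
  show "\<exists>!\<gamma>. is_gamma \<theta> (d_param \<theta> \<omega> k) \<sigma> \<gamma>" if "\<sigma> > 0" for \<sigma>
    by (rule is_gamma_ex1[OF d_eps_identity(1)[OF assms(4)] that])
  show "admits_phase_bound_state \<theta> \<omega> k \<sigma>1 \<sigma>2 1" if "\<sigma>2 > 0" for \<sigma>2
    using admits_phase_bound_state_of_exponents[OF assms(1) that assms(4)] by simp
  show "\<exists>\<delta>>0. \<forall>\<sigma>2. 0 < \<sigma>2 \<and> \<sigma>2 < \<delta> \<longrightarrow> admits_phase_bound_state \<theta> \<omega> k \<sigma>1 \<sigma>2 (-1)"
    using admits_phase_bound_state_of_exponents[OF assms(1) _ assms(4)] assms(1) by blast
qed

end
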